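(* Let $K$ be a field, $f\in K[Z]$ monic, irreducible and separable of degree $n$, $x_1,\dots,x_n$ a numbering of its zeros in the splitting field $L=K(x_1,\dots,x_n)$, and $G$ the Galois group of $L|K$. Put $K_i=K(x_1,\dots,x_i)$ ($K_0=K$), $G_i=\{\sigma\in G:\sigma(x_j)=x_j \text{ for all } j\le i\}$, let $f_i$ be the minimal polynomial of $x_i$ over $K_{i-1}$ and $d_i=\deg f_i$. Write $f_i=T_i^{d_i}+\sum_{k_i=1}^{d_i}b_{i,k_i}T_i^{d_i-k_i}$ and expand uniquely $b_{i,k_i}=\sum_{k_1=1}^{d_1}\cdots\sum_{k_{i-1}=1}^{d_{i-1}} b_{i,k_1,\dots,k_i}x_1^{d_1-k_1}\cdots x_{i-1}^{d_{i-1}-k_{i-1}}$ with $b_{i,k_1,\dots,k_i}\in K$, and set $\widehat{f_i}=T_i^{d_i}+\sum_{k_1=1}^{d_1}\cdots\sum_{k_i=1}^{d_i} b_{i,k_1,\dots,k_i}T_1^{d_1-k_1}\cdots T_i^{d_i-k_i}\in K[T_1,\dots,T_i]$. For $\rho\in G$ and $j\in\{1,\dots,n\}$ let $B(\rho,j)=\{\sigma(x_j):\sigma\in G,\ \sigma|_{K_{j-1}}=\rho|_{K_{j-1}}\}\setminus\{\rho(x_j)\}$. Then for each $i=1,\dots,n$, $$\widehat{f_i}=T_i^{d_i}-\sum_{\rho\in G/G_i}\rho(x_i)^{d_i}\prod_{y_1\in B(\rho,1)}\frac{T_1-y_1}{\rho(x_1)-y_1}\cdots\prod_{y_i\in B(\rho,i)}\frac{T_i-y_i}{\rho(x_i)-y_i},$$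 where the sum runs over a set of representatives $\rho$ of the left cosets $\rho G_i$ of $G_i$ in $G$.
   Context: The summand indexed by $\rho$ depends only on the coset $\rho G_i$ (it involves only $\rho(x_1),\dots,\rho(x_i)$ and the sets $B(\rho,j)$, $j\le i$). $T_1,\dots,T_n$ are indeterminates. *)

theory Defs
  imports
    "HOL-Computational_Algebra.Polynomial"
    "HOL-Library.Poly_Mapping"
    "HOL-Library.FuncSet"
begin

text \<open>
  The splitting field \<open>L\<close> is the whole type \<open>'a\<close>, and \<open>K\<close> and the intermediate fields are
  subsets of it. The zeros are given as a function \<open>x\<close> on \<open>nat\<close>, of which only
  the values at \<open>1, \<dots>, n\<close> matter.
\<close>

definition is_subfield :: "'a::field set \<Rightarrow> bool" where
  "is_subfield F \<longleftrightarrow> 0 \<in> F \<and> 1 \<in> F \<and>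
     (\<forall>a\<in>F. \<forall>b\<in>F. a - b \<in> F \<and> a * b \<in> F) \<and> (\<forall>a\<in>F. a \<noteq> 0 \<longrightarrow> inverse a \<in> F)"

definition field_adjoin :: "'a::field set \<Rightarrow> 'a set \<Rightarrow> 'a set" where
  "field_adjoin F S = \<Inter>{E. is_subfield E \<and> F \<subseteq> E \<and> S \<subseteq> E}"

definition polys_over :: "'a::field set \<Rightarrow> 'a poly set" where
  "polys_over F = {p. \<forall>k. coeff p k \<in> F}"

definition irreducible_over :: "'a::field set \<Rightarrow> 'a poly \<Rightarrow> bool" where
  "irreducible_over F p \<longleftrightarrow> p \<in> polys_over F \<and> degree p > 0 \<and>
     (\<forall>q\<in>polys_over F. \<forall>r\<in>polys_over F. p = q * r \<longrightarrow> degree q = 0 \<or> degree r = 0)"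

definition min_poly :: "'a::field set \<Rightarrow> 'a \<Rightarrow> 'a poly" where
  "min_poly F a = (THE p. p \<in> polys_over F \<and> lead_coeff p = 1 \<and> poly p a = 0 \<and>
     (\<forall>q\<in>polys_over F. q \<noteq> 0 \<and> poly q a = 0 \<longrightarrow> degree p \<le> degree q))"

definition Galois_group :: "'a::field set \<Rightarrow> ('a \<Rightarrow> 'a) set" where
  "Galois_group K = {\<sigma>. bij \<sigma> \<and> (\<forall>a b. \<sigma> (a + b) = \<sigma> a + \<sigma> b) \<and>
     (\<forall>a b. \<sigma> (a * b) = \<sigma> a * \<sigma> b) \<and> (\<forall>a\<in>K. \<sigma> a = a)}"

definition left_coset :: "('a \<Rightarrow> 'a) \<Rightarrow> ('a \<Rightarrow> 'a) set \<Rightarrow> ('a \<Rightarrow> 'a) set" where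
  "left_coset \<rho> H = (\<lambda>\<tau>. \<rho> \<circ> \<tau>) ` H"

definition left_coset_representatives ::
    "('a \<Rightarrow> 'a) set \<Rightarrow> ('a \<Rightarrow> 'a) set \<Rightarrow> ('a \<Rightarrow> 'a) set \<Rightarrow> bool" where
  "left_coset_representatives G H R \<longleftrightarrow>
     R \<subseteq> G \<and> bij_betw (\<lambda>\<rho>. left_coset \<rho> H) R ((\<lambda>\<sigma>. left_coset \<sigma> H) ` G)"

definition tower_field :: "'a::field set \<Rightarrow> (nat \<Rightarrow> 'a) \<Rightarrow> nat \<Rightarrow> 'a set" where
  "tower_field K x i = field_adjoin K (x ` {1..i})"

definition tower_stabilizer :: "'a::field set \<Rightarrow> (nat \<Rightarrow> 'a) \<Rightarrow> nat \<Rightarrow> ('a \<Rightarrow> 'a) set" where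
  "tower_stabilizer K x i = {\<sigma> \<in> Galois_group K. \<forall>j\<in>{1..i}. \<sigma> (x j) = x j}"

definition tower_poly :: "'a::field set \<Rightarrow> (nat \<Rightarrow> 'a) \<Rightarrow> nat \<Rightarrow> 'a poly" where
  "tower_poly K x i = min_poly (tower_field K x (i - 1)) (x i)"

definition tower_degree :: "'a::field set \<Rightarrow> (nat \<Rightarrow> 'a) \<Rightarrow> nat \<Rightarrow> nat" where
  "tower_degree K x i = degree (tower_poly K x i)"

text \<open>
  A multi-index \<open>(k\<^sub>1, \<dots>, k\<^sub>m)\<close> with \<open>1 \<le> k\<^sub>j \<le> d\<^sub>j\<close> is a function that is extensional on
  \<open>{1..m}\<close>; for \<open>m = 0\<close> there is exactly one.
\<close>

definition multi_indices :: "'a::field set \<Rightarrow> (nat \<Rightarrow> 'a) \<Rightarrow> nat \<Rightarrow> (nat \<Rightarrow> nat) set" where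
  "multi_indices K x m = (\<Pi>\<^sub>E j\<in>{1..m}. {1..tower_degree K x j})"

text \<open>
  The family of coefficients in \<open>K\<close> of the unique expansion of an element \<open>c\<close> of \<open>K\<^sub>m\<close> in the
  basis \<open>x\<^sub>1\<^bsup>d\<^sub>1 - k\<^sub>1\<^esup> \<cdots> x\<^sub>m\<^bsup>d\<^sub>m - k\<^sub>m\<^esup>\<close>.
\<close>

definition expansion_coeffs ::
    "'a::field set \<Rightarrow> (nat \<Rightarrow> 'a) \<Rightarrow> nat \<Rightarrow> 'a \<Rightarrow> (nat \<Rightarrow> nat) \<Rightarrow> 'a" where
  "expansion_coeffs K x m c = (THE a. a \<in> multi_indices K x m \<rightarrow>\<^sub>E K \<and>
     c = (\<Sum>k\<in>multi_indices K x m. a k * (\<Prod>j=1..m. x j ^ (tower_degree K x j - k j))))"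

text \<open>\<open>b_coeff K x i k\<close> is \<open>b\<^bsub>i,k\<^sub>1,\<dots>,k\<^sub>i\<^esub>\<close>; note that \<open>b\<^bsub>i,k\<^sub>i\<^esub>\<close> is the coefficient of
  \<open>f\<^sub>i\<close> at exponent \<open>d\<^sub>i - k\<^sub>i\<close>.\<close>

definition b_coeff :: "'a::field set \<Rightarrow> (nat \<Rightarrow> 'a) \<Rightarrow> nat \<Rightarrow> (nat \<Rightarrow> nat) \<Rightarrow> 'a" where
  "b_coeff K x i k =
     expansion_coeffs K x (i - 1) (coeff (tower_poly K x i) (tower_degree K x i - k i))
       (restrict k {1..i - 1})"

text \<open>Polynomials in the indeterminates \<open>T\<^sub>j\<close> (\<open>j :: nat\<close>): finitely supported maps from
  exponent vectors to coefficients, multiplied by convolution.\<close>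

type_synonym 'a mpoly = "(nat \<Rightarrow>\<^sub>0 nat) \<Rightarrow>\<^sub>0 'a"

definition T :: "nat \<Rightarrow> 'a::field mpoly" where
  "T j = Poly_Mapping.single (Poly_Mapping.single j 1) 1"

definition Const :: "'a::field \<Rightarrow> 'a mpoly" where
  "Const c = Poly_Mapping.single 0 c"

definition f_hat :: "'a::field set \<Rightarrow> (nat \<Rightarrow> 'a) \<Rightarrow> nat \<Rightarrow> 'a mpoly" where
  "f_hat K x i = T i ^ tower_degree K x i +
     (\<Sum>k\<in>multi_indices K x i.
        Const (b_coeff K x i k) * (\<Prod>j=1..i. T j ^ (tower_degree K x j - k j)))"

definition B :: "'a::field set \<Rightarrow> (nat \<Rightarrow> 'a) \<Rightarrow> ('a \<Rightarrow> 'a) \<Rightarrow> nat \<Rightarrow> 'a set" where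
  "B K x \<rho> j =
     {\<sigma> (x j) | \<sigma>. \<sigma> \<in> Galois_group K \<and> (\<forall>a\<in>tower_field K x (j - 1). \<sigma> a = \<rho> a)} - {\<rho> (x j)}"

end

theory Submission
  imports Defs
begin

text \<open>
  Apart from \<open>T\<^sub>i\<^bsup>d\<^sub>i\<^esup>\<close>, both sides have degree less than \<open>d\<^sub>j\<close> in each \<open>T\<^sub>j\<close>, and both
  vanish at all points \<open>(\<sigma> x\<^sub>1, \<dots>, \<sigma> x\<^sub>i)\<close> with \<open>\<sigma> \<in> G\<close>: the left side because its
  coefficients lie in \<open>K\<close>, the right side by Lagrange interpolation. These points determine such
  a polynomial, one variable at a time, because a given restriction of \<open>\<sigma>\<close> to \<open>K\<^bsub>j-1\<^esub>\<close> leaves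
  exactly \<open>d\<^sub>j\<close> values for \<open>\<sigma> x\<^sub>j\<close>. The same uniqueness shows that the monomials
  \<open>x\<^sub>1\<^bsup>d\<^sub>1 - k\<^sub>1\<^esup> \<cdots> x\<^sub>m\<^bsup>d\<^sub>m - k\<^sub>m\<^esup>\<close> are linearly independent over \<open>K\<close>.
\<close>

section \<open>Subfields and polynomials over them\<close>

lemma is_subfieldD:
  assumes "is_subfield F"
  shows subfield_0: "0 \<in> F" and subfield_1: "1 \<in> F"
    and subfield_diff: "a \<in> F \<Longrightarrow> b \<in> F \<Longrightarrow> a - b \<in> F"
    and subfield_mult: "a \<in> F \<Longrightarrow> b \<in> F \<Longrightarrow> a * b \<in> F"
    and subfield_inverse: "a \<in> F \<Longrightarrow> inverse a \<in> F"
  using assms unfolding is_subfield_def by (cases "a = 0"; auto)+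

lemma subfield_uminus: "is_subfield F \<Longrightarrow> a \<in> F \<Longrightarrow> - a \<in> F"
  using subfield_diff[of F 0 a] subfield_0 by auto

lemma subfield_add: "is_subfield F \<Longrightarrow> a \<in> F \<Longrightarrow> b \<in> F \<Longrightarrow> a + b \<in> F"
  using subfield_diff[of F a "- b"] subfield_uminus by auto

lemma subfield_sum: "is_subfield F \<Longrightarrow> (\<And>i. i \<in> A \<Longrightarrow> g i \<in> F) \<Longrightarrow> sum g A \<in> F"
  by (induction A rule: infinite_finite_induct) (auto intro: subfield_0 subfield_add)

lemma subfield_power: "is_subfield F \<Longrightarrow> a \<in> F \<Longrightarrow> a ^ k \<in> F"
  by (induction k) (auto intro: subfield_1 subfield_mult)

lemma polys_overD: "p \<in> polys_over F \<Longrightarrow> coeff p k \<in> F"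
  by (simp add: polys_over_def)

lemma polys_over_mono: "F \<subseteq> E \<Longrightarrow> p \<in> polys_over F \<Longrightarrow> p \<in> polys_over E"
  by (auto simp: polys_over_def)

lemma polys_over_const: "is_subfield F \<Longrightarrow> a \<in> F \<Longrightarrow> [:a:] \<in> polys_over F"
  by (auto simp: polys_over_def coeff_pCons subfield_0 split: nat.splits)

lemma polys_over_X: "is_subfield F \<Longrightarrow> [:0, 1:] \<in> polys_over F"
  by (auto simp: polys_over_def coeff_pCons subfield_0 subfield_1 split: nat.splits)

lemma polys_over_0: "is_subfield F \<Longrightarrow> 0 \<in> polys_over F"
  by (auto simp: polys_over_def subfield_0)

lemma polys_over_add:
  "is_subfield F \<Longrightarrow> p \<in> polys_over F \<Longrightarrow> q \<in> polys_over F \<Longrightarrow> p + q \<in> polys_over F"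
  by (auto simp: polys_over_def intro: subfield_add)

lemma polys_over_diff:
  "is_subfield F \<Longrightarrow> p \<in> polys_over F \<Longrightarrow> q \<in> polys_over F \<Longrightarrow> p - q \<in> polys_over F"
  by (auto simp: polys_over_def intro: subfield_diff)

lemma polys_over_uminus: "is_subfield F \<Longrightarrow> p \<in> polys_over F \<Longrightarrow> - p \<in> polys_over F"
  by (auto simp: polys_over_def intro: subfield_uminus)

lemma polys_over_mult:
  "is_subfield F \<Longrightarrow> p \<in> polys_over F \<Longrightarrow> q \<in> polys_over F \<Longrightarrow> p * q \<in> polys_over F"
  by (auto simp: polys_over_def coeff_mult intro!: subfield_sum subfield_mult)

lemma polys_over_smult:
  "is_subfield F \<Longrightarrow> a \<in> F \<Longrightarrow> p \<in> polys_over F \<Longrightarrow> smult a p \<in> polys_over F"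
  by (auto simp: polys_over_def intro: subfield_mult)

lemma polys_over_monom: "is_subfield F \<Longrightarrow> a \<in> F \<Longrightarrow> monom a k \<in> polys_over F"
  by (auto simp: polys_over_def subfield_0)

lemma poly_in_subfield:
  "is_subfield F \<Longrightarrow> p \<in> polys_over F \<Longrightarrow> a \<in> F \<Longrightarrow> poly p a \<in> F"
  unfolding poly_altdef by (auto intro!: subfield_sum subfield_mult subfield_power dest: polys_overD)

text \<open>Ordinary long division. The only division of scalars is by the leading coefficient of
  \<open>p\<close>, whose inverse lies in \<open>F\<close>, so quotient and remainder stay over
  \<open>F\<close>.\<close>

lemma polys_over_division:
  assumes F: "is_subfield F" and p: "p \<in> polys_over F" "p \<noteq> 0" and q: "q \<in> polys_over F"
  shows "\<exists>s\<in>polys_over F. \<exists>r\<in>polys_over F. q = p * s + r \<and> (r = 0 \<or> degree r < degree p)"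
  using q
proof (induction "degree q" arbitrary: q rule: less_induct)
  case less
  show ?case
  proof (cases "q = 0 \<or> degree q < degree p")
    case True
    then show ?thesis using less.prems polys_over_0[OF F] by (intro bexI[of _ 0] bexI[of _ q]) auto
  next
    case False
    define c where "c = lead_coeff q * inverse (lead_coeff p)"
    have c: "c \<in> F" "c \<noteq> 0" using False p polys_overD[OF less.prems] polys_overD[OF p(1)]
      by (auto simp: c_def intro: subfield_mult subfield_inverse F)
    define u where "u = monom c (degree q - degree p)"
    have u: "u \<in> polys_over F" using c F by (simp add: u_def polys_over_monom)
    define q' where "q' = q - p * u"
    have q': "q' \<in> polys_over F" using u less.prems p F by (simp add: q'_def polys_over_diff polys_over_mult)
    have deg: "degree (p * u) = degree q"
      using c p False by (simp add: u_def degree_mult_eq degree_monom_eq monom_eq_0_iff)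
    have lead: "coeff (p * u) (degree q) = lead_coeff q"
      using deg p lead_coeff_mult[of p u] c by (simp add: u_def degree_monom_eq) (simp add: c_def)
    show ?thesis
    proof (cases "q' = 0")
      case True
      then show ?thesis using u polys_over_0[OF F] by (intro bexI[of _ u] bexI[of _ 0]) (auto simp: q'_def)
    next
      case nz: False
      have le: "degree q' \<le> degree q" unfolding q'_def by (rule degree_diff_le) (auto simp: deg)
      have "coeff q' (degree q) = 0" using lead by (simp add: q'_def)
      then have "degree q' < degree q" using le nz leading_coeff_0_iff[of q']
        by (cases "degree q' = degree q") auto
      from less.hyps[OF this q'] obtain s r where
        sr: "s \<in> polys_over F" "r \<in> polys_over F" "q' = p * s + r" "r = 0 \<or> degree r < degree p" by blast
      have "q = p * (s + u) + r" using sr(3) by (simp add: q'_def algebra_simps)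
      then show ?thesis using sr u polys_over_add[OF F] by blast
    qed
  qed
qed

section \<open>Minimal polynomials and simple extensions\<close>

definition algebraic_over :: "'a::field set \<Rightarrow> 'a \<Rightarrow> bool" where
  "algebraic_over F c \<longleftrightarrow> (\<exists>g\<in>polys_over F. g \<noteq> 0 \<and> poly g c = 0)"

text \<open>A nonzero polynomial of least degree vanishing at \<open>c\<close>, divided by its
  leading coefficient, satisfies the definite description in \<open>min_poly\<close>. It is the only
  one: the difference of two such polynomials vanishes at \<open>c\<close>, and its leading terms
  cancel.\<close>

lemma min_poly_spec:
  assumes F: "is_subfield F" and alg: "algebraic_over F c"
  shows "min_poly F c \<in> polys_over F" "lead_coeff (min_poly F c) = 1" "poly (min_poly F c) c = 0"
    "min_poly F c \<noteq> 0" "0 < degree (min_poly F c)"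
    "q \<in> polys_over F \<Longrightarrow> q \<noteq> 0 \<Longrightarrow> poly q c = 0 \<Longrightarrow> degree (min_poly F c) \<le> degree q"
proof -
  from alg obtain g where g: "g \<in> polys_over F" "g \<noteq> 0" "poly g c = 0"
    unfolding algebraic_over_def by blast
  let ?P = "\<lambda>p. p \<in> polys_over F \<and> lead_coeff p = 1 \<and> poly p c = 0 \<and>
     (\<forall>q\<in>polys_over F. q \<noteq> 0 \<and> poly q c = 0 \<longrightarrow> degree p \<le> degree q)"
  obtain h where h: "h \<in> polys_over F \<and> h \<noteq> 0 \<and> poly h c = 0"
    and least: "\<And>q. q \<in> polys_over F \<and> q \<noteq> 0 \<and> poly q c = 0 \<Longrightarrow> degree h \<le> degree q"
    using ex_has_least_nat[of "\<lambda>q. q \<in> polys_over F \<and> q \<noteq> 0 \<and> poly q c = 0" g degree] g by blast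
  define p where "p = smult (inverse (lead_coeff h)) h"
  have p: "?P p" using h least
    by (auto simp: p_def intro!: polys_over_smult F subfield_inverse polys_overD)
  have "p' = p" if p': "?P p'" for p'
  proof (rule ccontr)
    assume ne: "p' \<noteq> p"
    have nz: "p \<noteq> 0" "p' \<noteq> 0" using p p' by auto
    have deg: "degree p' = degree p" using p p' nz by (auto intro!: antisym)
    have "p' - p \<in> polys_over F" "poly (p' - p) c = 0" using p p' F by (auto intro: polys_over_diff)
    then have ge: "degree p \<le> degree (p' - p)" using p ne by auto
    have "coeff (p' - p) (degree p) = 0" using p p' deg by simp
    moreover have "degree (p' - p) \<le> degree p" using deg by (intro degree_diff_le) auto
    ultimately have "lead_coeff (p' - p) = 0" using ge by (metis antisym)
    then show False using ne by (metis eq_iff_diff_eq_0 leading_coeff_0_iff)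
  qed
  then have "?P (min_poly F c)" unfolding min_poly_def using p by (intro theI[of ?P p]) blast+
  then show monic: "lead_coeff (min_poly F c) = 1" and root: "poly (min_poly F c) c = 0"
    and "min_poly F c \<in> polys_over F"
    "q \<in> polys_over F \<Longrightarrow> q \<noteq> 0 \<Longrightarrow> poly q c = 0 \<Longrightarrow> degree (min_poly F c) \<le> degree q" by auto
  show nz: "min_poly F c \<noteq> 0" using monic by auto
  show "0 < degree (min_poly F c)"
  proof (rule ccontr)
    assume "\<not> ?thesis"
    then obtain a where "min_poly F c = [:a:]" by (auto elim: degree_eq_zeroE)
    then show False using nz root by simp
  qed
qed

text \<open>The remainder of \<open>q\<close> modulo the minimal polynomial also vanishes at
  \<open>c\<close> but has smaller degree, so it is zero.\<close>

lemma min_poly_divides: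
  assumes F: "is_subfield F" and alg: "algebraic_over F c" and q: "q \<in> polys_over F" "poly q c = 0"
  shows "\<exists>s\<in>polys_over F. q = min_poly F c * s"
proof -
  note mp = min_poly_spec[OF F alg]
  from polys_over_division[OF F mp(1,4) q(1)] obtain s r where
    sr: "s \<in> polys_over F" "r \<in> polys_over F" "q = min_poly F c * s + r"
      "r = 0 \<or> degree r < degree (min_poly F c)" by blast
  have "poly r c = 0" using sr(3) q mp(3) by simp
  then have "r = 0" using mp(6)[OF sr(2)] sr(4) by linarith
  then show ?thesis using sr by auto
qed

lemma field_adjoin_props:
  shows is_subfield_field_adjoin: "is_subfield (field_adjoin F S)"
    and field_adjoin_base: "F \<subseteq> field_adjoin F S"
    and field_adjoin_gens: "S \<subseteq> field_adjoin F S"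
    and field_adjoin_least: "is_subfield E \<Longrightarrow> F \<subseteq> E \<Longrightarrow> S \<subseteq> E \<Longrightarrow> field_adjoin F S \<subseteq> E"
  unfolding field_adjoin_def is_subfield_def by blast+

lemma field_adjoin_field_adjoin:
  "field_adjoin (field_adjoin F S) S' = field_adjoin F (S \<union> S')"
  using field_adjoin_base[of F S] field_adjoin_gens[of S F]
    field_adjoin_base[of "field_adjoin F S" S'] field_adjoin_gens[of S' "field_adjoin F S"]
    field_adjoin_base[of F "S \<union> S'"] field_adjoin_gens[of "S \<union> S'" F]
  by (intro subset_antisym field_adjoin_least is_subfield_field_adjoin; blast)

lemma field_adjoin_empty: "is_subfield F \<Longrightarrow> field_adjoin F {} = F"
  by (intro subset_antisym field_adjoin_least field_adjoin_base) auto

text \<open>Euclid's algorithm on the pair consisting of the minimal polynomial and \<open>q\<close>, run as an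
  induction on the degree of \<open>q\<close>.\<close>
lemma simple_extension_inverse:
  assumes F: "is_subfield F" and alg: "algebraic_over F c"
    and q: "q \<in> polys_over F" "q \<noteq> 0" "degree q < degree (min_poly F c)"
  shows "\<exists>v\<in>polys_over F. poly q c * poly v c = 1"
  using q
proof (induction "degree q" arbitrary: q rule: less_induct)
  case less
  note mp = min_poly_spec[OF F alg]
  show ?case
  proof (cases "degree q = 0")
    case True
    then obtain a where a: "q = [:a:]" by (auto elim: degree_eq_zeroE)
    have "a \<in> F" "a \<noteq> 0" using less.prems polys_overD[of q F 0] a by auto
    then show ?thesis using a F
      by (intro bexI[of _ "[:inverse a:]"]) (auto intro: polys_over_const subfield_inverse)
  next
    case False
    have qc: "poly q c \<noteq> 0" using mp(6)[of q] less.prems by auto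
    from polys_over_division[OF F less.prems(1,2) mp(1)] obtain s r where
      sr: "s \<in> polys_over F" "r \<in> polys_over F" "min_poly F c = q * s + r"
        "r = 0 \<or> degree r < degree q" by blast
    have rc: "poly r c = - (poly q c * poly s c)" using mp(3) sr(3)
      by (metis add_eq_0_iff poly_add poly_mult)
    \<comment> \<open>Otherwise the cofactor \<open>s\<close> would vanish at \<open>c\<close>,
      although its degree is smaller than that of the minimal polynomial by
      \<open>degree q > 0\<close>.\<close>
    have "r \<noteq> 0"
    proof
      assume r: "r = 0"
      then have s: "s \<noteq> 0" "poly s c = 0" using rc qc sr mp(4) by auto
      have "degree (min_poly F c) = degree q + degree s"
        using sr(3) r s less.prems by (simp add: degree_mult_eq)
      with mp(6)[OF sr(1) s] False show False by simp
    qed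
    then have "degree r < degree q" using sr by auto
    then obtain w where w: "w \<in> polys_over F" "poly r c * poly w c = 1"
      using less.hyps[of r] sr \<open>r \<noteq> 0\<close> less.prems by auto
    \<comment> \<open>Since \<open>r\<close> takes the value \<open>- q(c) s(c)\<close> at
      \<open>c\<close>, an inverse \<open>w(c)\<close> of it yields the inverse
      \<open>- s(c) w(c)\<close> of \<open>q(c)\<close>.\<close>
    then have "poly q c * poly (- (s * w)) c = 1" using rc by (simp add: algebra_simps)
    then show ?thesis using w sr F by (meson polys_over_mult polys_over_uminus)
  qed
qed

text \<open>Reduction modulo the minimal polynomial brings the value at \<open>c\<close> of any
  polynomial over \<open>F\<close> into the set on the right. That set is therefore closed under the
  ring operations, and \<open>simple_extension_inverse\<close> supplies inverses.\<close>

lemma simple_extension_repr: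
  assumes F: "is_subfield F" and alg: "algebraic_over F c"
  shows "field_adjoin F {c} =
    {poly q c | q. q \<in> polys_over F \<and> degree q < degree (min_poly F c)}" (is "_ = ?E")
proof
  note mp = min_poly_spec[OF F alg]
  have E: "poly q c \<in> ?E" if q: "q \<in> polys_over F" for q
  proof -
    from polys_over_division[OF F mp(1,4) q] obtain s r where
      sr: "s \<in> polys_over F" "r \<in> polys_over F" "q = min_poly F c * s + r"
        "r = 0 \<or> degree r < degree (min_poly F c)" by blast
    then have "poly q c = poly r c" "degree r < degree (min_poly F c)" using mp by auto
    then show ?thesis using sr by auto
  qed
  have "is_subfield ?E"
    unfolding is_subfield_def
  proof (intro conjI ballI impI)
    show "0 \<in> ?E" using E[OF polys_over_0[OF F]] by simp
    show "1 \<in> ?E" using E[OF polys_over_const[OF F subfield_1[OF F]]] by simp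
  next
    fix a b assume "a \<in> ?E" "b \<in> ?E"
    then obtain p q where pq: "p \<in> polys_over F" "a = poly p c" "q \<in> polys_over F" "b = poly q c" by blast
    show "a - b \<in> ?E" using E[OF polys_over_diff[OF F pq(1,3)]] pq by simp
    show "a * b \<in> ?E" using E[OF polys_over_mult[OF F pq(1,3)]] pq by simp
  next
    fix a assume "a \<in> ?E" "a \<noteq> 0"
    then obtain p where p: "p \<in> polys_over F" "a = poly p c" "degree p < degree (min_poly F c)" by blast
    then have "p \<noteq> 0" using \<open>a \<noteq> 0\<close> by auto
    from simple_extension_inverse[OF F alg p(1) this p(3)] obtain v where
      v: "v \<in> polys_over F" "a * poly v c = 1" using p by blast
    then have "inverse a = poly v c" by (simp add: inverse_unique)
    then show "inverse a \<in> ?E" using E[OF v(1)] by simp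
  qed
  moreover have "F \<subseteq> ?E"
  proof
    fix a assume "a \<in> F"
    then show "a \<in> ?E" using E[OF polys_over_const[OF F]] by simp
  qed
  moreover have "{c} \<subseteq> ?E" using E[OF polys_over_X[OF F]] by simp
  ultimately show "field_adjoin F {c} \<subseteq> ?E" by (rule field_adjoin_least)
  show "?E \<subseteq> field_adjoin F {c}"
    using field_adjoin_gens[of "{c}" F]
    by (auto intro!: poly_in_subfield is_subfield_field_adjoin dest: polys_over_mono[OF field_adjoin_base])
qed

section \<open>Extending homomorphisms\<close>

text \<open>A field embedding of \<open>F\<close>, encoded as a total function whose values off
  \<open>F\<close> are arbitrary. The condition \<open>\<rho> 1 = 1\<close> rules out the zero map
  and makes \<open>\<rho>\<close> injective on a subfield.\<close>

definition hom_on :: "'a::field set \<Rightarrow> ('a \<Rightarrow> 'a) \<Rightarrow> bool" where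
  "hom_on F \<rho> \<longleftrightarrow> \<rho> 1 = 1 \<and>
     (\<forall>a\<in>F. \<forall>b\<in>F. \<rho> (a + b) = \<rho> a + \<rho> b \<and> \<rho> (a * b) = \<rho> a * \<rho> b)"

lemma hom_onD:
  assumes "hom_on F \<rho>"
  shows hom_on_1: "\<rho> 1 = 1"
    and hom_on_add: "a \<in> F \<Longrightarrow> b \<in> F \<Longrightarrow> \<rho> (a + b) = \<rho> a + \<rho> b"
    and hom_on_mult: "a \<in> F \<Longrightarrow> b \<in> F \<Longrightarrow> \<rho> (a * b) = \<rho> a * \<rho> b"
  using assms by (auto simp: hom_on_def)

lemma hom_on_0: "is_subfield F \<Longrightarrow> hom_on F \<rho> \<Longrightarrow> \<rho> 0 = 0"
  using hom_on_add[of F \<rho> 0 0] subfield_0[of F] add_cancel_left_left[of "\<rho> 0" "\<rho> 0"] by simp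

lemma hom_on_diff:
  "is_subfield F \<Longrightarrow> hom_on F \<rho> \<Longrightarrow> a \<in> F \<Longrightarrow> b \<in> F \<Longrightarrow> \<rho> (a - b) = \<rho> a - \<rho> b"
  using hom_on_add[of F \<rho> "a - b" b] by (simp add: subfield_diff)

lemma hom_on_sum:
  "is_subfield F \<Longrightarrow> hom_on F \<rho> \<Longrightarrow> (\<And>i. i \<in> A \<Longrightarrow> g i \<in> F) \<Longrightarrow> \<rho> (sum g A) = (\<Sum>i\<in>A. \<rho> (g i))"
  by (induction A rule: infinite_finite_induct)
    (auto simp: hom_on_0 hom_on_add subfield_sum)

lemma hom_on_power:
  "is_subfield F \<Longrightarrow> hom_on F \<rho> \<Longrightarrow> a \<in> F \<Longrightarrow> \<rho> (a ^ k) = \<rho> a ^ k"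
  by (induction k) (auto simp: hom_on_1 hom_on_mult subfield_power)

lemma hom_on_prod:
  "hom_on UNIV \<rho> \<Longrightarrow> \<rho> (prod g A) = (\<Prod>i\<in>A. \<rho> (g i))"
  by (induction A rule: infinite_finite_induct) (auto simp: hom_on_1 hom_on_mult)

lemma hom_on_inverse:
  assumes "is_subfield F" "hom_on F \<rho>" "a \<in> F"
  shows "\<rho> (inverse a) = inverse (\<rho> a)"
proof (cases "a = 0")
  case False
  then have "\<rho> a * \<rho> (inverse a) = 1"
    using hom_on_mult[OF assms(2,3), of "inverse a"] assms by (simp add: subfield_inverse hom_on_1)
  then show ?thesis by (simp add: inverse_unique)
qed (use assms in \<open>simp add: hom_on_0\<close>)

lemma hom_on_eq_0_iff:
  assumes "is_subfield F" "hom_on F \<rho>" "a \<in> F"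
  shows "\<rho> a = 0 \<longleftrightarrow> a = 0"
proof
  assume "\<rho> a = 0"
  show "a = 0"
  proof (rule ccontr)
    assume "a \<noteq> 0"
    then have "\<rho> a * \<rho> (inverse a) = 1"
      using hom_on_mult[OF assms(2,3), of "inverse a"] assms by (simp add: subfield_inverse hom_on_1)
    with \<open>\<rho> a = 0\<close> show False by simp
  qed
qed (use assms in \<open>simp add: hom_on_0\<close>)

lemma is_subfield_UNIV: "is_subfield UNIV"
  by (simp add: is_subfield_def)

lemma hom_on_subset: "hom_on E \<rho> \<Longrightarrow> F \<subseteq> E \<Longrightarrow> hom_on F \<rho>"
  unfolding hom_on_def by blast

context
  fixes F :: "'a::field set" and \<rho> :: "'a \<Rightarrow> 'a"
  assumes F: "is_subfield F" and hom: "hom_on F \<rho>"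
begin

lemma coeff_map_poly_hom: "coeff (map_poly \<rho> p) k = \<rho> (coeff p k)"
  by (simp add: coeff_map_poly hom_on_0[OF F hom])

lemma map_poly_hom_diff:
  "p \<in> polys_over F \<Longrightarrow> q \<in> polys_over F \<Longrightarrow> map_poly \<rho> (p - q) = map_poly \<rho> p - map_poly \<rho> q"
  by (auto simp: poly_eq_iff coeff_map_poly_hom polys_overD hom_on_diff[OF F hom])

lemma map_poly_hom_add:
  "p \<in> polys_over F \<Longrightarrow> q \<in> polys_over F \<Longrightarrow> map_poly \<rho> (p + q) = map_poly \<rho> p + map_poly \<rho> q"
  by (auto simp: poly_eq_iff coeff_map_poly_hom polys_overD hom_on_add[OF hom])

lemma map_poly_hom_mult:
  "p \<in> polys_over F \<Longrightarrow> q \<in> polys_over F \<Longrightarrow> map_poly \<rho> (p * q) = map_poly \<rho> p * map_poly \<rho> q"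
  by (auto simp: poly_eq_iff coeff_map_poly_hom coeff_mult polys_overD hom_on_sum[OF F hom]
      hom_on_mult[OF hom] subfield_mult[OF F])

lemma map_poly_hom_const: "map_poly \<rho> [:a:] = [:\<rho> a:]"
  by (auto simp: poly_eq_iff coeff_map_poly_hom coeff_pCons hom_on_0[OF F hom] split: nat.splits)

lemma map_poly_hom_X: "map_poly \<rho> [:0, 1:] = [:0, 1:]"
  by (auto simp: poly_eq_iff coeff_map_poly_hom coeff_pCons hom_on_0[OF F hom] hom_on_1[OF hom]
      split: nat.splits)

lemma degree_map_poly_hom: "p \<in> polys_over F \<Longrightarrow> degree (map_poly \<rho> p) = degree p"
  by (cases "p = 0") (auto intro!: map_poly_degree_eq simp: hom_on_eq_0_iff[OF F hom] polys_overD)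

lemma hom_poly:
  assumes "p \<in> polys_over F" "a \<in> F"
  shows "\<rho> (poly p a) = poly (map_poly \<rho> p) (\<rho> a)"
  using assms
  by (simp add: poly_altdef degree_map_poly_hom coeff_map_poly_hom hom_on_sum[OF F hom]
      hom_on_mult[OF hom] hom_on_power[OF F hom] polys_overD subfield_mult[OF F] subfield_power[OF F])

text \<open>The extension sends \<open>q(c)\<close> to the value at \<open>y\<close> of
  \<open>q\<close> with \<open>\<rho>\<close> applied to its coefficients. Two polynomials with the
  same value at \<open>c\<close> differ by a multiple of the minimal polynomial, whose image
  vanishes at \<open>y\<close>, so the choice of \<open>q\<close> does not matter.\<close>

lemma hom_extension:
  assumes alg: "algebraic_over F c" and y: "poly (map_poly \<rho> (min_poly F c)) y = 0"
  shows "\<exists>\<tau>. hom_on (field_adjoin F {c}) \<tau> \<and> (\<forall>a\<in>F. \<tau> a = \<rho> a) \<and> \<tau> c = y"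
proof -
  note mp = min_poly_spec[OF F alg]
  define \<tau> where "\<tau> z = poly (map_poly \<rho> (SOME q. q \<in> polys_over F \<and> poly q c = z)) y" for z
  have \<tau>: "\<tau> (poly q c) = poly (map_poly \<rho> q) y" if q: "q \<in> polys_over F" for q
  proof -
    define q' where "q' = (SOME q'. q' \<in> polys_over F \<and> poly q' c = poly q c)"
    have q': "q' \<in> polys_over F \<and> poly q' c = poly q c"
      unfolding q'_def by (rule someI[of _ q]) (use q in simp)
    have d: "q - q' \<in> polys_over F" using q q' F by (simp add: polys_over_diff)
    moreover have "poly (q - q') c = 0" using q' by simp
    ultimately obtain s where s: "s \<in> polys_over F" "q - q' = min_poly F c * s"
      using min_poly_divides[OF F alg] by blast
    have "map_poly \<rho> q - map_poly \<rho> q' = map_poly \<rho> (min_poly F c) * map_poly \<rho> s"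
      using s q q' mp(1) by (metis map_poly_hom_diff map_poly_hom_mult)
    then have "poly (map_poly \<rho> q) y - poly (map_poly \<rho> q') y = 0"
      by (metis poly_diff poly_mult y mult_zero_left)
    then show ?thesis unfolding \<tau>_def q'_def by simp
  qed
  have ext: "\<tau> a = \<rho> a" if "a \<in> F" for a
    using \<tau>[OF polys_over_const[OF F that]] by (simp add: map_poly_hom_const)
  moreover have "\<tau> c = y"
    using \<tau>[OF polys_over_X[OF F]] by (simp add: map_poly_hom_X)
  moreover have "hom_on (field_adjoin F {c}) \<tau>"
    unfolding hom_on_def simple_extension_repr[OF F alg]
  proof (intro conjI ballI)
    show "\<tau> 1 = 1" using ext[OF subfield_1[OF F]] hom_on_1[OF hom] by simp
  next
    fix a b
    assume "a \<in> {poly q c |q. q \<in> polys_over F \<and> degree q < degree (min_poly F c)}"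
      "b \<in> {poly q c |q. q \<in> polys_over F \<and> degree q < degree (min_poly F c)}"
    then obtain p q where pq: "p \<in> polys_over F" "a = poly p c" "q \<in> polys_over F" "b = poly q c" by blast
    show "\<tau> (a + b) = \<tau> a + \<tau> b"
      using \<tau>[OF polys_over_add[OF F pq(1,3)]] pq by (simp add: \<tau> map_poly_hom_add)
    show "\<tau> (a * b) = \<tau> a * \<tau> b"
      using \<tau>[OF polys_over_mult[OF F pq(1,3)]] pq by (simp add: \<tau> map_poly_hom_mult)
  qed
  ultimately show ?thesis by blast
qed

end

section \<open>The Galois group of the tower\<close>

text \<open>A repeated value of \<open>x\<close> would produce a squared linear factor and hence a
  root of order at least 2.\<close>

lemma inj_on_if_rsquarefree_prod:
  assumes "rsquarefree (\<Prod>i\<in>A. [:- x i, 1:])" "finite A"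
  shows "inj_on x A"
proof (rule inj_onI, rule ccontr)
  fix a b assume ab: "a \<in> A" "b \<in> A" "x a = x b" "a \<noteq> b"
  let ?f = "\<Prod>i\<in>A. [:- x i, 1:]"
  have "?f = [:- x a, 1:] * ([:- x b, 1:] * (\<Prod>i\<in>A - {a} - {b}. [:- x i, 1:]))"
    using ab assms(2) by (simp add: prod.remove[of A a] prod.remove[of "A - {a}" b])
  then have "?f = [:- x a, 1:] ^ 2 * (\<Prod>i\<in>A - {a} - {b}. [:- x i, 1:])"
    using ab(3) by (simp only: power2_eq_square mult.assoc)
  then have "[:- x a, 1:] ^ 2 dvd ?f" by (metis dvd_triv_left)
  then have "2 \<le> order (x a) ?f" using assms by (subst (asm) order_divides) (auto simp: rsquarefree_def)
  moreover have "order (x a) ?f = 0 \<or> order (x a) ?f = 1" using assms(1) by (auto simp: rsquarefree_def)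
  ultimately show False by auto
qed

text \<open>The roots of \<open>g\<close> and of \<open>h\<close> together cover \<open>X\<close>,
  which has \<open>degree g + degree h\<close> elements. Neither factor has more roots than its
  degree, so both bounds are attained.\<close>

lemma card_roots_of_divisor:
  fixes g h :: "'a::field poly"
  assumes "finite X" "g * h = (\<Prod>a\<in>X. [:- a, 1:])"
  shows "card {y. poly g y = 0} = degree g"
proof -
  have nz: "g \<noteq> 0" "h \<noteq> 0" using assms by auto
  have "X = {y. poly (g * h) y = 0}" unfolding assms(2) using assms(1)
    by (auto simp: poly_prod)
  also have "\<dots> = {y. poly g y = 0} \<union> {y. poly h y = 0}" by auto
  finally have "card X \<le> card {y. poly g y = 0} + card {y. poly h y = 0}"
    by (metis card_Un_le)
  moreover have "card X = degree (g * h)" unfolding assms(2)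
    by (subst degree_prod_sum_eq) auto
  ultimately show ?thesis using card_poly_roots_bound[OF nz(1)] card_poly_roots_bound[OF nz(2)]
    degree_mult_eq[OF nz] by linarith
qed

section \<open>Sums indexed by reversed exponents \<open>d - e\<close> with
  \<open>1 \<le> e \<le> d\<close>\<close>

lemma sum_reverse_exponents:
  fixes d :: nat
  shows "(\<Sum>e=1..d. h (d - e)) = (\<Sum>e<d. h e)"
  by (rule sum.reindex_bij_witness[of _ "\<lambda>e. d - e" "\<lambda>e. d - e"]) auto

lemma poly_eq_sum_lessThan:
  fixes z :: "'a::comm_semiring_1"
  assumes "degree q < D"
  shows "poly q z = (\<Sum>e<D. coeff q e * z ^ e)"
  unfolding poly_altdef using assms
  by (intro sum.mono_neutral_left) (auto simp: coeff_eq_0)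

lemma poly_eq_sum_reverse:
  fixes z :: "'a::comm_semiring_1"
  assumes "degree q < D"
  shows "poly q z = (\<Sum>e=1..D. coeff q (D - e) * z ^ (D - e))"
  unfolding poly_eq_sum_lessThan[OF assms] by (rule sum_reverse_exponents[symmetric])

text \<open>Separability enters as \<open>inj_x\<close>: it makes \<open>f\<close> a product over a
  set of distinct roots, which is what the count of conjugates needs.\<close>

locale root_tower =
  fixes K :: "'a::field set" and f :: "'a poly" and x :: "nat \<Rightarrow> 'a" and n :: nat
  assumes K: "is_subfield K" and f: "f \<in> polys_over K"
    and f_split: "f = (\<Prod>i=1..n. [:- x i, 1:])"
    and inj_x: "inj_on x {1..n}"
    and generated: "field_adjoin K (x ` {1..n}) = UNIV"
begin

abbreviation "E \<equiv> tower_field K x"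
abbreviation "G \<equiv> Galois_group K"
abbreviation "d \<equiv> tower_degree K x"
abbreviation "\<Delta> \<equiv> multi_indices K x"
abbreviation "monomial m k y \<equiv> (\<Prod>j=1..m. y j ^ (d j - k j))"

section \<open>The tower of fields generated by the roots\<close>

lemma subfield_E: "is_subfield (E m)"
  unfolding tower_field_def by (rule is_subfield_field_adjoin)

lemma K_subset_E: "K \<subseteq> E m"
  unfolding tower_field_def by (rule field_adjoin_base)

lemma E_0: "E 0 = K"
  unfolding tower_field_def using K by (simp add: field_adjoin_empty)

lemma E_n: "E n = UNIV"
  unfolding tower_field_def by (rule generated)

lemma E_Suc: "E (Suc m) = field_adjoin (E m) {x (Suc m)}"
  unfolding tower_field_def field_adjoin_field_adjoin
  by (simp add: atLeastAtMostSuc_conv)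

lemma E_Suc_mono: "E m \<subseteq> E (Suc m)"
  unfolding E_Suc by (rule field_adjoin_base)

lemma f_nonzero: "f \<noteq> 0"
  unfolding f_split by simp

lemma poly_f_eq_0_iff: "poly f y = 0 \<longleftrightarrow> y \<in> x ` {1..n}"
  unfolding f_split by (auto simp: poly_prod)

lemma x_algebraic: "j \<in> {1..n} \<Longrightarrow> algebraic_over (E m) (x j)"
  unfolding algebraic_over_def using f_nonzero poly_f_eq_0_iff polys_over_mono[OF K_subset_E f]
  by (intro bexI[of _ f]) auto

lemma tower_poly_spec:
  assumes "m < n"
  shows "tower_poly K x (Suc m) \<in> polys_over (E m)" "lead_coeff (tower_poly K x (Suc m)) = 1"
    "poly (tower_poly K x (Suc m)) (x (Suc m)) = 0" "0 < d (Suc m)"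
  using min_poly_spec(1-5)[OF subfield_E x_algebraic, of "Suc m" m] assms
  by (auto simp: tower_poly_def tower_degree_def)

section \<open>Automorphisms over \<open>K\<close> and their action on the roots\<close>

lemma Galois_hom: "\<sigma> \<in> G \<Longrightarrow> hom_on UNIV \<sigma>"
  using subfield_1[OF K] unfolding Galois_group_def hom_on_def by blast

lemma Galois_fixes: "\<sigma> \<in> G \<Longrightarrow> a \<in> K \<Longrightarrow> \<sigma> a = a"
  unfolding Galois_group_def by blast

lemma hom_permutes_roots:
  assumes hom: "hom_on UNIV \<sigma>" and fix_K: "\<And>a. a \<in> K \<Longrightarrow> \<sigma> a = a" and j: "j \<in> {1..n}"
  shows "\<sigma> (x j) \<in> x ` {1..n}"
proof -
  have map_f: "map_poly \<sigma> f = f"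
    using polys_overD[OF f] fix_K
    by (intro poly_eqI) (simp add: coeff_map_poly_hom[OF is_subfield_UNIV hom])
  have "poly f (x j) = 0" using j by (simp add: poly_f_eq_0_iff)
  then have "poly f (\<sigma> (x j)) = 0"
    using hom_poly[OF is_subfield_UNIV hom, of f "x j"] hom_on_0[OF is_subfield_UNIV hom] map_f
    by (simp add: polys_over_def)
  then show ?thesis by (simp add: poly_f_eq_0_iff)
qed

text \<open>Bijectivity is automatic. The map is injective, so it permutes the finite set of roots.
  Its range is then a subfield containing \<open>K\<close> and all roots, hence everything.\<close>

lemma Galois_groupI:
  assumes hom: "hom_on UNIV \<sigma>" and fix_K: "\<And>a. a \<in> K \<Longrightarrow> \<sigma> a = a"
  shows "\<sigma> \<in> G"
proof -
  have inj: "inj \<sigma>"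
  proof (rule injI)
    fix a b assume "\<sigma> a = \<sigma> b"
    then have "\<sigma> (a - b) = 0" using hom_on_diff[OF is_subfield_UNIV hom] by simp
    then show "a = b" using hom_on_eq_0_iff[OF is_subfield_UNIV hom] by simp
  qed
  have "\<sigma> ` x ` {1..n} \<subseteq> x ` {1..n}"
    using hom_permutes_roots[OF hom fix_K] by blast
  then have roots: "\<sigma> ` x ` {1..n} = x ` {1..n}"
    using card_image[OF inj_on_subset[OF inj subset_UNIV], of "x ` {1..n}"]
    by (intro card_subset_eq) simp_all
  have "is_subfield (range \<sigma>)"
    unfolding is_subfield_def
  proof (intro conjI ballI impI)
    show "0 \<in> range \<sigma>" "1 \<in> range \<sigma>"
      using rangeI[of \<sigma> 0] rangeI[of \<sigma> 1] hom_on_0[OF is_subfield_UNIV hom] hom_on_1[OF hom]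
      by simp_all
  next
    fix a b assume "a \<in> range \<sigma>" "b \<in> range \<sigma>"
    then obtain a' b' where "a = \<sigma> a'" "b = \<sigma> b'" by blast
    then show "a - b \<in> range \<sigma>" "a * b \<in> range \<sigma>"
      using rangeI[of \<sigma> "a' - b'"] rangeI[of \<sigma> "a' * b'"]
      by (simp_all add: hom_on_diff[OF is_subfield_UNIV hom] hom_on_mult[OF hom])
  next
    fix a assume "a \<in> range \<sigma>"
    then obtain a' where "a = \<sigma> a'" by blast
    then show "inverse a \<in> range \<sigma>"
      using rangeI[of \<sigma> "inverse a'"] by (simp add: hom_on_inverse[OF is_subfield_UNIV hom])
  qed
  moreover have "K \<subseteq> range \<sigma>" by (metis fix_K rangeI subsetI)
  moreover have "x ` {1..n} \<subseteq> range \<sigma>" using roots by blast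
  ultimately have "field_adjoin K (x ` {1..n}) \<subseteq> range \<sigma>" by (rule field_adjoin_least)
  then have "bij \<sigma>" using inj generated by (auto simp: bij_def)
  then show ?thesis using hom fix_K by (auto simp: Galois_group_def hom_on_def)
qed

lemma Galois_permutes_roots: "\<sigma> \<in> G \<Longrightarrow> j \<in> {1..n} \<Longrightarrow> \<sigma> (x j) \<in> x ` {1..n}"
  by (rule hom_permutes_roots[OF Galois_hom Galois_fixes])

text \<open>Over \<open>E m\<close> the tower polynomial divides \<open>f\<close>. Applying
  \<open>\<rho>\<close> to the coefficients leaves \<open>f\<close> unchanged, so the conjugate
  polynomial is again a divisor of a product of distinct linear factors.\<close>

lemma card_conjugate_roots:
  assumes m: "m < n" and hom: "hom_on (E m) \<rho>" and fix_K: "\<And>a. a \<in> K \<Longrightarrow> \<rho> a = a"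
  shows "card {y. poly (map_poly \<rho> (tower_poly K x (Suc m))) y = 0} = d (Suc m)"
proof -
  have f': "f \<in> polys_over (E m)" by (rule polys_over_mono[OF K_subset_E f])
  have "poly f (x (Suc m)) = 0" using m by (auto simp: poly_f_eq_0_iff)
  then obtain s where s: "s \<in> polys_over (E m)" "f = tower_poly K x (Suc m) * s"
    using min_poly_divides[OF subfield_E x_algebraic f', of "Suc m"] m by (auto simp: tower_poly_def)
  have map_f: "map_poly \<rho> f = f"
    using polys_overD[OF f] fix_K
    by (intro poly_eqI) (simp add: coeff_map_poly_hom[OF subfield_E hom])
  have "map_poly \<rho> (tower_poly K x (Suc m)) * map_poly \<rho> s = f"
    using map_poly_hom_mult[OF subfield_E hom tower_poly_spec(1)[OF m] s(1)] s(2) map_f by simp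
  also have "f = (\<Prod>a\<in>x ` {1..n}. [:- a, 1:])"
    unfolding f_split prod.reindex[OF inj_x] by simp
  finally show ?thesis
    by (subst card_roots_of_divisor)
      (auto simp: tower_degree_def degree_map_poly_hom[OF subfield_E hom tower_poly_spec(1)[OF m]])
qed

lemma Galois_extension:
  assumes "m \<le> n" "hom_on (E m) \<rho>" "\<And>a. a \<in> K \<Longrightarrow> \<rho> a = a"
  shows "\<exists>\<tau>\<in>G. \<forall>a\<in>E m. \<tau> a = \<rho> a"
  using assms
\<comment> \<open>The induction runs downwards from \<open>n\<close>, where \<open>E n\<close> is
  the whole type. Each step adjoins one more root and then extends from
  \<open>Suc m\<close>.\<close>
proof (induction arbitrary: \<rho> rule: inc_induct)
  case base
  then show ?case using Galois_groupI[of \<rho>] by (auto simp: E_n)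
next
  case (step m)
  \<comment> \<open>A target for \<open>x (Suc m)\<close> exists because the conjugate polynomial
    has a positive number of roots.\<close>
  have "{y. poly (map_poly \<rho> (tower_poly K x (Suc m))) y = 0} \<noteq> {}"
    using card_conjugate_roots[OF step.hyps(2) step.prems] tower_poly_spec(4)[OF step.hyps(2)]
    by (metis card.empty less_irrefl)
  then obtain y where "poly (map_poly \<rho> (min_poly (E m) (x (Suc m)))) y = 0"
    by (auto simp: tower_poly_def)
  from hom_extension[OF subfield_E step.prems(1) x_algebraic this] step.hyps obtain \<tau> where
    \<tau>: "hom_on (E (Suc m)) \<tau>" "\<forall>a\<in>E m. \<tau> a = \<rho> a" by (auto simp: E_Suc)
  with step.prems K_subset_E have "\<And>a. a \<in> K \<Longrightarrow> \<tau> a = a" by (metis subsetD)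
  from step.IH[OF \<tau>(1) this] obtain \<tau>' where "\<tau>' \<in> G" "\<forall>a\<in>E (Suc m). \<tau>' a = \<tau> a" by blast
  with \<tau> E_Suc_mono show ?case by (metis subsetD)
qed

text \<open>From left to right, \<open>\<sigma>\<close> and \<open>\<rho>\<close> agree on the
  coefficients of the tower polynomial. Conversely, a root \<open>y\<close> is a legitimate image of
  \<open>x (Suc m)\<close> by \<open>hom_extension\<close>, and the resulting embedding extends to
  the whole field.\<close>

lemma conjugates_eq_roots:
  assumes m: "m < n" and \<rho>: "\<rho> \<in> G"
  shows "{\<sigma> (x (Suc m)) | \<sigma>. \<sigma> \<in> G \<and> (\<forall>a\<in>E m. \<sigma> a = \<rho> a)} =
    {y. poly (map_poly \<rho> (tower_poly K x (Suc m))) y = 0}" (is "?A = ?R")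
proof (intro equalityI subsetI)
  fix y assume "y \<in> ?A"
  then obtain \<sigma> where \<sigma>: "\<sigma> \<in> G" "\<forall>a\<in>E m. \<sigma> a = \<rho> a" "y = \<sigma> (x (Suc m))" by blast
  have "map_poly \<rho> (tower_poly K x (Suc m)) = map_poly \<sigma> (tower_poly K x (Suc m))"
    using \<sigma>(2) tower_poly_spec(1)[OF m]
    by (intro poly_eqI) (simp add: coeff_map_poly_hom[OF is_subfield_UNIV Galois_hom] \<sigma> \<rho> polys_overD)
  then show "y \<in> ?R"
    using hom_poly[OF is_subfield_UNIV Galois_hom[OF \<sigma>(1)], of "tower_poly K x (Suc m)" "x (Suc m)"]
      tower_poly_spec(3)[OF m] hom_on_0[OF is_subfield_UNIV Galois_hom[OF \<sigma>(1)]] \<sigma>(3)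
    by (simp add: polys_over_def)
next
  fix y assume "y \<in> ?R"
  then have y: "poly (map_poly \<rho> (min_poly (E m) (x (Suc m)))) y = 0" by (simp add: tower_poly_def)
  have hom: "hom_on (E m) \<rho>" using Galois_hom[OF \<rho>] by (rule hom_on_subset) simp
  from hom_extension[OF subfield_E hom x_algebraic y] m obtain \<tau> where
    \<tau>: "hom_on (E (Suc m)) \<tau>" "\<forall>a\<in>E m. \<tau> a = \<rho> a" "\<tau> (x (Suc m)) = y" by (auto simp: E_Suc)
  then have "\<And>a. a \<in> K \<Longrightarrow> \<tau> a = a" using Galois_fixes[OF \<rho>] K_subset_E by (metis subsetD)
  from Galois_extension[OF _ \<tau>(1) this] m obtain \<sigma> where
    \<sigma>: "\<sigma> \<in> G" "\<forall>a\<in>E (Suc m). \<sigma> a = \<tau> a" by auto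
  moreover have "x (Suc m) \<in> E (Suc m)" unfolding E_Suc using field_adjoin_gens by blast
  ultimately show "y \<in> ?A" using \<tau> E_Suc_mono by (intro CollectI exI[of _ \<sigma>]) (metis subsetD)
qed

lemma card_conjugates:
  assumes "m < n" "\<rho> \<in> G"
  shows "card {\<sigma> (x (Suc m)) | \<sigma>. \<sigma> \<in> G \<and> (\<forall>a\<in>E m. \<sigma> a = \<rho> a)} = d (Suc m)"
  unfolding conjugates_eq_roots[OF assms]
  by (rule card_conjugate_roots[OF assms(1) hom_on_subset[OF Galois_hom[OF assms(2)] subset_UNIV]
        Galois_fixes[OF assms(2)]])

lemma finite_conjugates:
  assumes "m < n" "\<rho> \<in> G"
  shows "finite {\<sigma> (x (Suc m)) | \<sigma>. \<sigma> \<in> G \<and> (\<forall>a\<in>E m. \<sigma> a = \<rho> a)}"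
  \<comment> \<open>An infinite set has cardinality 0 by convention, so a positive cardinality
    implies finiteness.\<close>
  by (rule card_ge_0_finite) (simp only: card_conjugates[OF assms] tower_poly_spec(4)[OF assms(1)])

text \<open>The elements on which two automorphisms agree form a subfield; here it contains the
  generators of \<open>E m\<close>.\<close>

lemma Galois_agree_tower:
  assumes "\<sigma> \<in> G" "\<rho> \<in> G" "\<And>j. j \<in> {1..m} \<Longrightarrow> \<sigma> (x j) = \<rho> (x j)" "a \<in> E m"
  shows "\<sigma> a = \<rho> a"
proof -
  note U = is_subfield_UNIV
  note h = Galois_hom[OF assms(1)] Galois_hom[OF assms(2)]
  have "is_subfield {a. \<sigma> a = \<rho> a}"
    unfolding is_subfield_def
    by (auto simp: h[THEN hom_on_1] hom_on_0[OF U h(1)] hom_on_0[OF U h(2)]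
        hom_on_diff[OF U h(1)] hom_on_diff[OF U h(2)] hom_on_mult[OF h(1)] hom_on_mult[OF h(2)]
        hom_on_inverse[OF U h(1)] hom_on_inverse[OF U h(2)])
  then have "E m \<subseteq> {a. \<sigma> a = \<rho> a}"
    unfolding tower_field_def using assms(3) Galois_fixes[OF assms(1)] Galois_fixes[OF assms(2)]
    by (intro field_adjoin_least) auto
  then show ?thesis using assms(4) by blast
qed

section \<open>Polynomials supported on the box of multi-indices\<close>

text \<open>The last index is split off. Extensional functions on \<open>{1..m}\<close> are
  \<open>undefined\<close> at \<open>Suc m\<close>, so \<open>e\<close> and \<open>k\<close> can be
  recovered from \<open>k(Suc m := e)\<close>.\<close>

lemma sum_multi_indices_Suc:
  "(\<Sum>k\<in>\<Delta> (Suc m). h k) = (\<Sum>e=1..d (Suc m). \<Sum>k\<in>\<Delta> m. h (k(Suc m := e)))"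
proof -
  have "\<Delta> (Suc m) = (\<lambda>(e, k). k(Suc m := e)) ` ({1..d (Suc m)} \<times> \<Delta> m)"
    unfolding multi_indices_def by (simp add: atLeastAtMostSuc_conv PiE_insert_eq)
  moreover have "inj_on (\<lambda>(e, k). k(Suc m := e)) ({1..d (Suc m)} \<times> \<Delta> m)"
    unfolding multi_indices_def using inj_combinator[of "Suc m" "{1..m}" "\<lambda>j. {1..d j}"] by simp
  ultimately show ?thesis
    by (simp add: sum.reindex sum.cartesian_product case_prod_unfold)
qed

lemma monomial_Suc:
  "monomial (Suc m) (k(Suc m := e)) y = monomial m k y * y (Suc m) ^ (d (Suc m) - e)"
proof -
  have "monomial m (k(Suc m := e)) y = monomial m k y" by (intro prod.cong) auto
  then show ?thesis by (simp add: atLeastAtMostSuc_conv mult.commute)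
qed

lemma multi_indices_SucE:
  assumes "k \<in> \<Delta> (Suc m)"
  obtains k' e where "k = k'(Suc m := e)" "k' \<in> \<Delta> m" "e \<in> {1..d (Suc m)}"
proof -
  have "k \<in> (\<lambda>(e, k). k(Suc m := e)) ` ({1..d (Suc m)} \<times> \<Delta> m)"
    using assms unfolding multi_indices_def by (simp add: atLeastAtMostSuc_conv PiE_insert_eq)
  then show thesis using that by (elim imageE) (simp add: case_prod_unfold mem_Times_iff)
qed

lemma multi_index_restrict:
  assumes "k \<in> \<Delta> m"
  shows "restrict (k(Suc m := e)) {1..m} = k"
proof -
  have "restrict (k(Suc m := e)) {1..m} = restrict k {1..m}" by (intro restrict_ext) auto
  then show ?thesis using assms PiE_restrict[of k "{1..m}"] by (simp add: multi_indices_def)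
qed

text \<open>Specialising all but the last variable leaves a univariate polynomial of degree less than
  \<open>d\<^sub>m\<close> with \<open>d\<^sub>m\<close> zeros.\<close>
lemma box_polynomial_zero:
  assumes "m \<le> n" "\<forall>\<sigma>\<in>G. (\<Sum>k\<in>\<Delta> m. a k * monomial m k (\<lambda>j. \<sigma> (x j))) = 0"
  shows "\<forall>k\<in>\<Delta> m. a k = 0"
  using assms
proof (induction m arbitrary: a)
  case 0
  have "id \<in> G" by (auto simp: Galois_group_def)
  with 0(2) show ?case by (auto simp: multi_indices_def)
next
  case (Suc m)
  show ?case
  proof
    fix k assume "k \<in> \<Delta> (Suc m)"
    then obtain k' e where k: "k = k'(Suc m := e)" "k' \<in> \<Delta> m" "e \<in> {1..d (Suc m)}"
      by (rule multi_indices_SucE)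
    have m: "m < n" using Suc.prems(1) by simp
    have inner: "(\<Sum>k\<in>\<Delta> m. a (k(Suc m := e)) * monomial m k (\<lambda>j. \<sigma> (x j))) = 0" if \<sigma>: "\<sigma> \<in> G" for \<sigma>
    proof -
      define c where "c e = (\<Sum>k\<in>\<Delta> m. a (k(Suc m := e)) * monomial m k (\<lambda>j. \<sigma> (x j)))" for e
      define g where "g = (\<Sum>e=1..d (Suc m). monom (c e) (d (Suc m) - e))"
      have coeff_g: "coeff g (d (Suc m) - e) = c e" if "e \<in> {1..d (Suc m)}" for e
      proof -
        have "coeff g (d (Suc m) - e) = (\<Sum>e'=1..d (Suc m). if e' = e then c e' else 0)"
          unfolding g_def coeff_sum by (rule sum.cong) (use that in auto)
        then show ?thesis using that by simp
      qed
      have deg: "degree g < d (Suc m)" if "g \<noteq> 0"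
      proof -
        have "degree g \<le> d (Suc m) - 1" unfolding g_def
          by (intro degree_sum_le) (auto intro: order.trans[OF degree_monom_le])
        then show ?thesis using tower_poly_spec(4)[OF m] by linarith
      qed
      let ?C = "{\<tau> (x (Suc m)) | \<tau>. \<tau> \<in> G \<and> (\<forall>a\<in>E m. \<tau> a = \<sigma> a)}"
      have "?C \<subseteq> {y. poly g y = 0}"
      proof clarify
        fix \<tau> assume \<tau>: "\<tau> \<in> G" "\<forall>a\<in>E m. \<tau> a = \<sigma> a"
        have "\<tau> (x j) = \<sigma> (x j)" if "j \<in> {1..m}" for j
          using \<tau>(2) field_adjoin_gens[of "x ` {1..m}" K] that unfolding tower_field_def by blast
        \<comment> \<open>The first \<open>m\<close> coordinates are the same for all these
          \<open>\<tau>\<close>, so all the values \<open>\<tau> (x (Suc m))\<close> are roots of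
          the single polynomial \<open>g\<close>.\<close>
        then have *: "monomial m k (\<lambda>j. \<tau> (x j)) = monomial m k (\<lambda>j. \<sigma> (x j))" for k
          by (intro prod.cong) auto
        have "0 = (\<Sum>k\<in>\<Delta> (Suc m). a k * monomial (Suc m) k (\<lambda>j. \<tau> (x j)))"
          using Suc.prems(2) \<tau>(1) by simp
        also have "\<dots> = (\<Sum>e=1..d (Suc m). c e * \<tau> (x (Suc m)) ^ (d (Suc m) - e))"
          unfolding sum_multi_indices_Suc monomial_Suc c_def * by (simp add: sum_distrib_right mult.assoc)
        also have "\<dots> = poly g (\<tau> (x (Suc m)))"
          by (simp add: g_def poly_sum poly_monom)
        finally show "poly g (\<tau> (x (Suc m))) = 0" by simp
      qed
      then have "g = 0"
        using card_conjugates[OF m \<sigma>] card_mono[OF poly_roots_finite, of g ?C] card_poly_roots_bound[of g] deg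
        by fastforce
      then have "c e = 0" using coeff_g[OF k(3)] by simp
      then show ?thesis by (simp add: c_def)
    qed
    \<comment> \<open>The slice of \<open>a\<close> with last index \<open>e\<close> satisfies the
      hypothesis in one variable fewer.\<close>
    have "\<forall>k\<in>\<Delta> m. a (k(Suc m := e)) = 0"
      using Suc.IH[of "\<lambda>k. a (k(Suc m := e))", OF less_imp_le[OF m]] inner by blast
    from bspec[OF this k(2)] show "a k = 0" by (simp only: k(1))
  qed
qed

text \<open>An element of \<open>E (Suc m)\<close> is a polynomial of degree below
  \<open>d (Suc m)\<close> in \<open>x (Suc m)\<close> over \<open>E m\<close>; each of its
  coefficients is expanded by induction.\<close>

lemma expansion_exists:
  assumes "m \<le> n" "c \<in> E m"
  shows "\<exists>a. (\<forall>k\<in>\<Delta> m. a k \<in> K) \<and> c = (\<Sum>k\<in>\<Delta> m. a k * monomial m k x)"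
  using assms
proof (induction m arbitrary: c)
  case 0
  then show ?case by (intro exI[of _ "\<lambda>_. c"]) (auto simp: multi_indices_def E_0)
next
  case (Suc m)
  then have m: "m < n" by simp
  have "algebraic_over (E m) (x (Suc m))" using m by (intro x_algebraic) auto
  then obtain q where q: "c = poly q (x (Suc m))" "q \<in> polys_over (E m)" "degree q < d (Suc m)"
    using Suc.prems(2) simple_extension_repr[OF subfield_E, of m "x (Suc m)"]
    unfolding E_Suc tower_degree_def tower_poly_def by auto
  have "\<forall>e. \<exists>a. (\<forall>k\<in>\<Delta> m. a k \<in> K) \<and> coeff q e = (\<Sum>k\<in>\<Delta> m. a k * monomial m k x)"
    using Suc.IH m polys_overD[OF q(2)] by simp
  from choice[OF this] obtain b where b: "\<And>e k. k \<in> \<Delta> m \<Longrightarrow> b e k \<in> K"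
    "\<And>e. coeff q e = (\<Sum>k\<in>\<Delta> m. b e k * monomial m k x)" by blast
  \<comment> \<open>The last index selects the coefficient of \<open>q\<close>, at exponent
    \<open>d (Suc m) - k (Suc m)\<close>; the other indices address its expansion.\<close>
  define a where "a k = b (d (Suc m) - k (Suc m)) (restrict k {1..m})" for k
  have "c = (\<Sum>e=1..d (Suc m). coeff q (d (Suc m) - e) * x (Suc m) ^ (d (Suc m) - e))"
    unfolding q(1) by (rule poly_eq_sum_reverse[OF q(3)])
  also have "\<dots> = (\<Sum>k\<in>\<Delta> (Suc m). a k * monomial (Suc m) k x)"
    unfolding sum_multi_indices_Suc monomial_Suc b(2) sum_distrib_right
    by (intro sum.cong refl) (simp only: a_def multi_index_restrict fun_upd_same mult.assoc)
  finally have "c = (\<Sum>k\<in>\<Delta> (Suc m). a k * monomial (Suc m) k x)" .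
  moreover have "a k \<in> K" if "k \<in> \<Delta> (Suc m)" for k
    using that by (elim multi_indices_SucE) (simp only: a_def multi_index_restrict fun_upd_same b(1))
  ultimately show ?case by blast
qed

text \<open>This carries a relation over \<open>K\<close> from the point of roots to all its
  conjugate points, as \<open>\<sigma>\<close> fixes the coefficients.\<close>

lemma Galois_monomial_sum:
  assumes \<sigma>: "\<sigma> \<in> G" and a: "\<And>k. k \<in> \<Delta> m \<Longrightarrow> a k \<in> K"
  shows "\<sigma> (\<Sum>k\<in>\<Delta> m. a k * monomial m k x) = (\<Sum>k\<in>\<Delta> m. a k * monomial m k (\<lambda>j. \<sigma> (x j)))"
  using Galois_fixes[OF \<sigma> a] hom_on_mult[OF Galois_hom[OF \<sigma>]]
  by (simp add: hom_on_sum[OF is_subfield_UNIV Galois_hom[OF \<sigma>]] hom_on_prod[OF Galois_hom[OF \<sigma>]]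
    hom_on_power[OF is_subfield_UNIV Galois_hom[OF \<sigma>]])

text \<open>The definite description is meaningful: the difference of two expansions vanishes at the
  roots, hence at all conjugate points, and \<open>box_polynomial_zero\<close> makes its
  coefficients zero.\<close>

lemma expansion_coeffs_spec:
  assumes m: "m \<le> n" and c: "c \<in> E m"
  shows "expansion_coeffs K x m c \<in> \<Delta> m \<rightarrow>\<^sub>E K"
    and "c = (\<Sum>k\<in>\<Delta> m. expansion_coeffs K x m c k * monomial m k x)"
proof -
  let ?P = "\<lambda>a. a \<in> \<Delta> m \<rightarrow>\<^sub>E K \<and> c = (\<Sum>k\<in>\<Delta> m. a k * monomial m k x)"
  obtain a where a: "\<forall>k\<in>\<Delta> m. a k \<in> K" "c = (\<Sum>k\<in>\<Delta> m. a k * monomial m k x)"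
    using expansion_exists[OF m c] by blast
  \<comment> \<open>Restriction fixes the value \<open>undefined\<close> off the box, which
    uniqueness as a function requires.\<close>
  have P: "?P (restrict a (\<Delta> m))" using a by auto
  have "a' = restrict a (\<Delta> m)" if a': "?P a'" for a'
  proof (rule PiE_ext)
    show "a' \<in> \<Delta> m \<rightarrow>\<^sub>E K" "restrict a (\<Delta> m) \<in> \<Delta> m \<rightarrow>\<^sub>E K" using a' P by auto
    fix k assume k: "k \<in> \<Delta> m"
    let ?b = "\<lambda>k. a' k - a k"
    have bK: "?b k \<in> K" if "k \<in> \<Delta> m" for k using that a a' subfield_diff[OF K] by auto
    have "(\<Sum>k\<in>\<Delta> m. ?b k * monomial m k x) = 0"
      using a a' by (simp add: left_diff_distrib sum_subtractf)
    then have *: "(\<Sum>k\<in>\<Delta> m. ?b k * monomial m k (\<lambda>j. \<sigma> (x j))) = 0" if "\<sigma> \<in> G" for \<sigma>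
      using Galois_monomial_sum[OF that, of m ?b, OF bK] hom_on_0[OF is_subfield_UNIV Galois_hom[OF that]] by simp
    have "\<forall>k\<in>\<Delta> m. ?b k = 0" using * by (intro box_polynomial_zero m ballI)
    then show "a' k = restrict a (\<Delta> m) k" using k by simp
  qed
  then have "?P (expansion_coeffs K x m c)"
    unfolding expansion_coeffs_def using P by (rule theI[of ?P, rotated])
  then show "expansion_coeffs K x m c \<in> \<Delta> m \<rightarrow>\<^sub>E K"
    "c = (\<Sum>k\<in>\<Delta> m. expansion_coeffs K x m c k * monomial m k x)" by auto
qed

end

section \<open>Lagrange interpolation on the orbit of the roots\<close>

lemma Const_0: "Const 0 = 0"
  by (simp add: Const_def)

lemma Const_1: "Const 1 = 1"
  by (simp add: Const_def)

lemma Const_add: "Const (a + b) = Const a + Const b"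
  by (simp add: Const_def single_add)

lemma Const_uminus: "Const (- a) = - Const a"
  by (simp add: Const_def single_uminus)

lemma Const_mult: "Const (a * b) = Const a * Const b"
  by (simp add: Const_def mult_single)

lemma Const_sum: "Const (sum g A) = (\<Sum>i\<in>A. Const (g i))"
  by (induction A rule: infinite_finite_induct) (auto simp: Const_0 Const_add)

lemma Const_prod: "Const (prod g A) = (\<Prod>i\<in>A. Const (g i))"
  by (induction A rule: infinite_finite_induct) (auto simp: Const_1 Const_mult)

definition poly_in_T :: "nat \<Rightarrow> 'a::field poly \<Rightarrow> 'a mpoly" where
  "poly_in_T j q = poly (map_poly Const q) (T j)"

lemma poly_in_T_0: "poly_in_T j 0 = 0"
  by (simp add: poly_in_T_def)

lemma poly_in_T_1: "poly_in_T j 1 = 1"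
  by (simp add: poly_in_T_def Const_1)

lemma poly_in_T_pCons: "poly_in_T j (pCons a q) = Const a + T j * poly_in_T j q"
  by (simp add: poly_in_T_def map_poly_pCons Const_0)

lemma poly_in_T_add: "poly_in_T j (p + q) = poly_in_T j p + poly_in_T j q"
  by (induction p q rule: poly_induct2) (simp_all add: poly_in_T_pCons poly_in_T_0 Const_add algebra_simps)

lemma poly_in_T_smult: "poly_in_T j (smult a q) = Const a * poly_in_T j q"
  by (induction q) (simp_all add: poly_in_T_pCons poly_in_T_0 Const_mult algebra_simps)

lemma poly_in_T_mult: "poly_in_T j (p * q) = poly_in_T j p * poly_in_T j q"
  by (induction p) (simp_all add: poly_in_T_pCons poly_in_T_0 poly_in_T_add poly_in_T_smult Const_0 algebra_simps)

lemma poly_in_T_prod: "poly_in_T j (prod g A) = (\<Prod>y\<in>A. poly_in_T j (g y))"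
  by (induction A rule: infinite_finite_induct) (auto simp: poly_in_T_1 poly_in_T_mult)

lemma poly_in_T_eq_sum_reverse:
  assumes "degree q < D"
  shows "poly_in_T j q = (\<Sum>e=1..D. Const (coeff q (D - e)) * T j ^ (D - e))"
proof -
  have "degree (map_poly Const q) < D" using map_poly_degree_leq[of Const q] assms by simp
  from poly_eq_sum_reverse[OF this] show ?thesis
    by (simp add: poly_in_T_def coeff_map_poly Const_0)
qed

text \<open>For finite \<open>Y\<close> not containing \<open>c\<close>, this is the Lagrange basis
  polynomial with value 1 at \<open>c\<close> and 0 on \<open>Y\<close>.\<close>

definition lagrange_poly :: "'a::field \<Rightarrow> 'a set \<Rightarrow> 'a poly" where
  "lagrange_poly c Y = (\<Prod>y\<in>Y. smult (1 / (c - y)) [:- y, 1:])"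

lemma poly_lagrange: "poly (lagrange_poly c Y) z = (\<Prod>y\<in>Y. (z - y) / (c - y))"
  by (simp add: lagrange_poly_def poly_prod diff_divide_distrib)

lemma degree_lagrange_le: "degree (lagrange_poly c Y) \<le> card Y"
proof (cases "finite Y")
  case True
  have "degree (lagrange_poly c Y) \<le> (\<Sum>y\<in>Y. degree (smult (1 / (c - y)) [:- y, 1:]))"
    unfolding lagrange_poly_def using degree_prod_sum_le[OF True] unfolding o_def .
  also have "\<dots> \<le> (\<Sum>y\<in>Y. 1)"
    by (intro sum_mono order.trans[OF degree_smult_le]) simp
  finally show ?thesis by simp
qed (simp add: lagrange_poly_def)

lemma poly_in_T_lagrange:
  "poly_in_T j (lagrange_poly c Y) = (\<Prod>y\<in>Y. (T j - Const y) * Const (1 / (c - y)))"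
  unfolding lagrange_poly_def poly_in_T_prod poly_in_T_smult
  by (intro prod.cong refl)
    (simp add: poly_in_T_pCons poly_in_T_0 Const_uminus Const_1 algebra_simps)

context root_tower
begin

text \<open>Summing the expansions of the lower coefficients of the tower polynomial, evaluated at
  the roots, reassembles its value at \<open>x i\<close> without the leading term. That value is 0,
  so minus the leading term remains.\<close>

lemma b_coeff_props:
  assumes i: "i \<in> {1..n}"
  shows b_coeff_in_K: "k \<in> \<Delta> i \<Longrightarrow> b_coeff K x i k \<in> K"
    and b_coeff_sum: "(\<Sum>k\<in>\<Delta> i. b_coeff K x i k * monomial i k x) = - (x i ^ d i)"
proof -
  obtain m where m: "i = Suc m" "m < n" using i by (cases i) auto
  define p where "p = tower_poly K x i"
  have p: "p \<in> polys_over (E m)" "coeff p (d i) = 1" "poly p (x i) = 0"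
    using tower_poly_spec[OF m(2)] unfolding p_def m(1) tower_degree_def by auto
  have b: "b_coeff K x i (k(Suc m := e)) = expansion_coeffs K x m (coeff p (d i - e)) k"
    if "k \<in> \<Delta> m" for k e
    using multi_index_restrict[OF that] unfolding b_coeff_def m(1) p_def by simp
  note spec = expansion_coeffs_spec[OF less_imp_le[OF m(2)] polys_overD[OF p(1)]]
  show "b_coeff K x i k \<in> K" if "k \<in> \<Delta> i"
  proof -
    from that obtain k' e where k: "k = k'(Suc m := e)" "k' \<in> \<Delta> m"
      unfolding m(1) by (rule multi_indices_SucE)
    then show ?thesis using PiE_mem[OF spec(1) k(2)] unfolding k(1) b[OF k(2)] by simp
  qed
  have "(\<Sum>k\<in>\<Delta> i. b_coeff K x i k * monomial i k x) =
      (\<Sum>e=1..d i. \<Sum>k\<in>\<Delta> m. expansion_coeffs K x m (coeff p (d i - e)) k * monomial m k x * x i ^ (d i - e))"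
    unfolding m(1) sum_multi_indices_Suc monomial_Suc
    by (intro sum.cong refl) (simp only: b[unfolded m(1)] mult.assoc)
  also have "\<dots> = (\<Sum>e=1..d i. coeff p (d i - e) * x i ^ (d i - e))"
    unfolding sum_distrib_right[symmetric] spec(2)[symmetric] ..
  also have "\<dots> = (\<Sum>e<d i. coeff p e * x i ^ e)" by (rule sum_reverse_exponents)
  also have "\<dots> = poly p (x i) - x i ^ d i"
  proof -
    \<comment> \<open>The bound \<open>Suc (d i)\<close> includes the leading term, which then
      splits off with coefficient 1.\<close>
    have "degree p < Suc (d i)" unfolding tower_degree_def p_def by simp
    from poly_eq_sum_lessThan[OF this] show ?thesis by (simp add: p(2))
  qed
  finally show "(\<Sum>k\<in>\<Delta> i. b_coeff K x i k * monomial i k x) = - (x i ^ d i)"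
    using p(3) by simp
qed

text \<open>The coefficient ring is left general because the expansion serves both for values at
  conjugate points and for formal polynomials in the \<open>T j\<close>.\<close>

lemma prod_sum_box:
  fixes c :: "nat \<Rightarrow> nat \<Rightarrow> 'b::comm_semiring_1"
  shows "(\<Prod>j=1..i. \<Sum>e=1..d j. c j (d j - e) * y j ^ (d j - e)) =
    (\<Sum>k\<in>\<Delta> i. (\<Prod>j=1..i. c j (d j - k j)) * monomial i k y)"
  unfolding multi_indices_def by (subst prod_sum_PiE) (simp_all add: prod.distrib)

section \<open>The interpolation nodes\<close>

lemma B_Suc:
  "B K x \<rho> (Suc m) = {\<sigma> (x (Suc m)) | \<sigma>. \<sigma> \<in> G \<and> (\<forall>a\<in>E m. \<sigma> a = \<rho> a)} - {\<rho> (x (Suc m))}"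
  by (simp add: B_def)

lemma finite_B: "\<rho> \<in> G \<Longrightarrow> j \<in> {1..n} \<Longrightarrow> finite (B K x \<rho> j)"
  using finite_conjugates[of "j - 1" \<rho>] by (cases j) (auto simp: B_Suc)

text \<open>The \<open>d j\<close> conjugates lose the element \<open>\<rho> (x j)\<close>. Thus
  each Lagrange factor has degree below \<open>d j\<close> and fits into the box.\<close>

lemma card_B_less:
  assumes "\<rho> \<in> G" "j \<in> {1..n}"
  shows "card (B K x \<rho> j) < d j"
proof -
  obtain m where m: "j = Suc m" "m < n" using assms(2) by (cases j) auto
  have "\<rho> (x (Suc m)) \<in> {\<sigma> (x (Suc m)) | \<sigma>. \<sigma> \<in> G \<and> (\<forall>a\<in>E m. \<sigma> a = \<rho> a)}" using assms(1) by blast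
  from card_Diff1_less[OF finite_conjugates[OF m(2) assms(1)] this] show ?thesis
    unfolding m(1) B_Suc card_conjugates[OF m(2) assms(1)] .
qed

text \<open>If \<open>\<sigma>\<close> and \<open>\<rho>\<close> first differ at \<open>x\<^sub>j\<close>, then \<open>\<sigma> x\<^sub>j\<close> is one of the nodes in
  \<open>B(\<rho>, j)\<close>.\<close>
lemma lagrange_orthogonality:
  assumes \<rho>: "\<rho> \<in> G" and \<sigma>: "\<sigma> \<in> G" and i: "i \<in> {1..n}"
  shows "(\<Prod>j=1..i. poly (lagrange_poly (\<rho> (x j)) (B K x \<rho> j)) (\<sigma> (x j))) =
    (if \<forall>j\<in>{1..i}. \<sigma> (x j) = \<rho> (x j) then 1 else 0)"
proof (cases "\<forall>j\<in>{1..i}. \<sigma> (x j) = \<rho> (x j)")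
  case True
  \<comment> \<open>Every factor is a quotient of equal terms, nonzero because \<open>B\<close>
    omits \<open>\<rho> (x j)\<close>.\<close>
  have "poly (lagrange_poly (\<rho> (x j)) (B K x \<rho> j)) (\<rho> (x j)) = 1" for j
    unfolding poly_lagrange by (intro prod.neutral) (auto simp: B_def)
  then show ?thesis using True by simp
next
  case False
  define j where "j = (LEAST j. j \<in> {1..i} \<and> \<sigma> (x j) \<noteq> \<rho> (x j))"
  have j: "j \<in> {1..i} \<and> \<sigma> (x j) \<noteq> \<rho> (x j)"
    unfolding j_def by (rule LeastI_ex) (use False in blast)
  have least: "\<sigma> (x k) = \<rho> (x k)" if "k \<in> {1..j - 1}" for k
  proof (rule ccontr)
    assume "\<sigma> (x k) \<noteq> \<rho> (x k)"
    moreover have "k \<in> {1..i}" "k < j" using that j by auto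
    ultimately show False using not_less_Least[of k "\<lambda>j. j \<in> {1..i} \<and> \<sigma> (x j) \<noteq> \<rho> (x j)"]
      by (auto simp: j_def)
  qed
  have "\<forall>a\<in>E (j - 1). \<sigma> a = \<rho> a"
    using Galois_agree_tower[OF \<sigma> \<rho> least] by blast
  then have mem: "\<sigma> (x j) \<in> B K x \<rho> j" using \<sigma> j by (auto simp: B_def)
  have fin: "finite (B K x \<rho> j)" using j i by (intro finite_B \<rho>) auto
  have "poly (lagrange_poly (\<rho> (x j)) (B K x \<rho> j)) (\<sigma> (x j)) = 0"
    unfolding poly_lagrange by (rule prod_zero[OF fin]) (use mem in force)
  then have "(\<Prod>j=1..i. poly (lagrange_poly (\<rho> (x j)) (B K x \<rho> j)) (\<sigma> (x j))) = 0"
    using j by (intro prod_zero) auto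
  then show ?thesis using False by auto
qed

text \<open>Elements of the stabilizer do not change the images of the first \<open>i\<close> roots.
  Conversely, if the images under \<open>\<rho>\<close> and \<open>\<sigma>\<close> agree, the
  inverse of \<open>\<sigma>\<close> composed with any element of the coset of \<open>\<rho>\<close>
  fixes these roots.\<close>

lemma left_coset_eq_iff:
  assumes \<rho>: "\<rho> \<in> G" and \<sigma>: "\<sigma> \<in> G"
  shows "left_coset \<rho> (tower_stabilizer K x i) = left_coset \<sigma> (tower_stabilizer K x i) \<longleftrightarrow>
    (\<forall>j\<in>{1..i}. \<sigma> (x j) = \<rho> (x j))"
proof
  let ?H = "tower_stabilizer K x i"
  assume eq: "left_coset \<rho> ?H = left_coset \<sigma> ?H"
  have "id \<in> ?H" by (auto simp: tower_stabilizer_def Galois_group_def)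
  then have "\<rho> \<circ> id \<in> left_coset \<rho> ?H" unfolding left_coset_def by (rule imageI)
  then have "\<rho> \<in> left_coset \<sigma> ?H" unfolding eq comp_id .
  then obtain \<tau> where \<tau>: "\<tau> \<in> ?H" "\<rho> = \<sigma> \<circ> \<tau>" unfolding left_coset_def by (rule imageE)
  show "\<forall>j\<in>{1..i}. \<sigma> (x j) = \<rho> (x j)"
    using \<tau>(1) unfolding \<tau>(2) tower_stabilizer_def by simp
next
  let ?H = "tower_stabilizer K x i"
  have sub: "left_coset \<rho> ?H \<subseteq> left_coset \<sigma> ?H"
    if \<rho>: "\<rho> \<in> G" and \<sigma>: "\<sigma> \<in> G" and agree: "\<forall>j\<in>{1..i}. \<sigma> (x j) = \<rho> (x j)" for \<rho> \<sigma>
  proof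
    fix \<phi> assume "\<phi> \<in> left_coset \<rho> ?H"
    then obtain \<tau> where \<tau>: "\<tau> \<in> ?H" "\<phi> = \<rho> \<circ> \<tau>" by (auto simp: left_coset_def)
    have b: "bij \<sigma>" using \<sigma> by (simp add: Galois_group_def)
    define \<psi> where "\<psi> = inv \<sigma> \<circ> \<phi>"
    have \<phi>: "\<phi> \<in> G" using \<tau> \<rho> by (auto simp: tower_stabilizer_def Galois_group_def bij_comp)
    have eq: "\<sigma> (\<psi> a) = \<phi> a" for a using b by (simp add: \<psi>_def bij_is_surj surj_f_inv_f)
    have inj: "\<sigma> a = \<sigma> b \<Longrightarrow> a = b" for a b using b by (auto simp: bij_def inj_def)
    \<comment> \<open>Each identity for \<open>\<psi>\<close> is checked after applying the
      injective map \<open>\<sigma>\<close>, which turns \<open>\<psi>\<close> into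
      \<open>\<phi>\<close>.\<close>
    have "\<psi> \<in> G"
    proof -
      have "bij \<psi>" using \<phi> b by (auto simp: \<psi>_def Galois_group_def intro!: bij_comp bij_imp_bij_inv)
      moreover have "\<psi> (a + b) = \<psi> a + \<psi> b" "\<psi> (a * b) = \<psi> a * \<psi> b" for a b
        by (rule inj, simp add: eq hom_on_add[OF Galois_hom[OF \<phi>]] hom_on_add[OF Galois_hom[OF \<sigma>]]
            hom_on_mult[OF Galois_hom[OF \<phi>]] hom_on_mult[OF Galois_hom[OF \<sigma>]])+
      moreover have "\<psi> a = a" if "a \<in> K" for a
        by (rule inj) (simp add: eq Galois_fixes[OF \<phi> that] Galois_fixes[OF \<sigma> that])
      ultimately show ?thesis by (auto simp: Galois_group_def)
    qed
    moreover have "\<psi> (x j) = x j" if "j \<in> {1..i}" for j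
      by (rule inj) (use \<tau> that agree in \<open>simp add: eq tower_stabilizer_def\<close>)
    ultimately have "\<psi> \<in> ?H" by (simp add: tower_stabilizer_def)
    moreover have "\<phi> = \<sigma> \<circ> \<psi>" by (auto simp: eq)
    ultimately show "\<phi> \<in> left_coset \<sigma> ?H" by (auto simp: left_coset_def)
  qed
  assume "\<forall>j\<in>{1..i}. \<sigma> (x j) = \<rho> (x j)"
  then show "left_coset \<rho> ?H = left_coset \<sigma> ?H"
    using sub[OF \<rho> \<sigma>] sub[OF \<sigma> \<rho>] by auto
qed

section \<open>Interpolation over coset representatives\<close>

context
  fixes i R
  assumes i: "i \<in> {1..n}"
    and R: "left_coset_representatives G (tower_stabilizer K x i) R"
begin

lemma R_subset: "R \<subseteq> G"
  using R by (simp add: left_coset_representatives_def)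

lemma representative_ex1:
  assumes \<sigma>: "\<sigma> \<in> G"
  shows "\<exists>!\<rho>. \<rho> \<in> R \<and> (\<forall>j\<in>{1..i}. \<sigma> (x j) = \<rho> (x j))"
proof -
  let ?c = "\<lambda>\<rho>. left_coset \<rho> (tower_stabilizer K x i)"
  have bij: "bij_betw ?c R (?c ` G)" using R by (simp add: left_coset_representatives_def)
  have "?c \<sigma> \<in> ?c ` R" using \<sigma> bij by (auto simp: bij_betw_def)
  then obtain \<rho> where \<rho>: "\<rho> \<in> R" "?c \<rho> = ?c \<sigma>" by force
  show ?thesis
  proof (intro ex1I conjI)
    show "\<rho> \<in> R" by (rule \<rho>)
    show "\<forall>j\<in>{1..i}. \<sigma> (x j) = \<rho> (x j)"
      using \<rho> R_subset \<sigma> left_coset_eq_iff by (metis subsetD)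
    fix \<rho>' assume \<rho>': "\<rho>' \<in> R \<and> (\<forall>j\<in>{1..i}. \<sigma> (x j) = \<rho>' (x j))"
    then have "?c \<rho>' = ?c \<rho>" using \<rho> R_subset \<sigma> left_coset_eq_iff[of \<rho>' \<sigma>] by (metis subsetD)
    then show "\<rho>' = \<rho>" using bij \<rho> \<rho>' by (auto simp: bij_betw_def inj_on_def)
  qed
qed

text \<open>Distinct representatives give distinct tuples of roots. Finiteness matters because a sum
  over an infinite set is 0 by convention.\<close>

lemma finite_representatives: "finite R"
proof (rule inj_on_finite)
  show "inj_on (\<lambda>\<rho>. restrict (\<lambda>j. \<rho> (x j)) {1..i}) R"
  proof (rule inj_onI)
    fix \<rho> \<rho>' assume *: "\<rho> \<in> R" "\<rho>' \<in> R"
      "restrict (\<lambda>j. \<rho> (x j)) {1..i} = restrict (\<lambda>j. \<rho>' (x j)) {1..i}"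
    then have agree: "\<forall>j\<in>{1..i}. \<rho> (x j) = \<rho>' (x j)" by (metis restrict_apply')
    have "\<rho> \<in> G" using *(1) R_subset by blast
    from representative_ex1[OF this] show "\<rho> = \<rho>'" using *(1,2) agree by blast
  qed
  show "(\<lambda>\<rho>. restrict (\<lambda>j. \<rho> (x j)) {1..i}) ` R \<subseteq> {1..i} \<rightarrow>\<^sub>E x ` {1..n}"
  proof (rule image_subsetI, rule restrict_PiE_iff[THEN iffD2], rule ballI)
    fix \<rho> j assume \<rho>: "\<rho> \<in> R" and j: "j \<in> {1..i}"
    have "\<rho> \<in> G" using \<rho> R_subset by blast
    moreover have "j \<in> {1..n}" using i j by auto
    ultimately show "\<rho> (x j) \<in> x ` {1..n}" by (rule Galois_permutes_roots)
  qed
qed (auto intro: finite_PiE)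

text \<open>At the conjugate point of \<open>\<sigma>\<close> the \<open>b_coeff\<close> sum equals
  \<open>- (\<sigma> (x i) ^ d i)\<close>. In the interpolation sum only the representative of the
  coset of \<open>\<sigma>\<close> survives, and it contributes the opposite value;
  \<open>box_polynomial_zero\<close> concludes.\<close>

lemma b_coeff_eq_interpolation:
  assumes k: "k \<in> \<Delta> i"
  shows "b_coeff K x i k = - (\<Sum>\<rho>\<in>R. \<rho> (x i) ^ d i *
    (\<Prod>j=1..i. coeff (lagrange_poly (\<rho> (x j)) (B K x \<rho> j)) (d j - k j)))"
proof -
  define w where "w \<rho> k = (\<Prod>j=1..i. coeff (lagrange_poly (\<rho> (x j)) (B K x \<rho> j)) (d j - k j))"
    for \<rho> and k :: "nat \<Rightarrow> nat"
  \<comment> \<open>The coefficient at \<open>k\<close> of the difference of the two sides;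
    \<open>w \<rho> k\<close> is that of the product of Lagrange polynomials.\<close>
  define a where "a k = b_coeff K x i k + (\<Sum>\<rho>\<in>R. \<rho> (x i) ^ d i * w \<rho> k)" for k
  have "\<forall>k\<in>\<Delta> i. a k = 0"
  proof (rule box_polynomial_zero)
    show "i \<le> n" using i by simp
    show "\<forall>\<sigma>\<in>G. (\<Sum>k\<in>\<Delta> i. a k * monomial i k (\<lambda>j. \<sigma> (x j))) = 0"
    proof
      fix \<sigma> assume \<sigma>: "\<sigma> \<in> G"
      let ?m = "\<lambda>k. monomial i k (\<lambda>j. \<sigma> (x j))"
      have "(\<Sum>k\<in>\<Delta> i. b_coeff K x i k * ?m k) = \<sigma> (- (x i ^ d i))"
        using Galois_monomial_sum[OF \<sigma>, of i "b_coeff K x i", OF b_coeff_in_K[OF i]] b_coeff_sum[OF i]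
        by simp
      also have "\<dots> = - (\<sigma> (x i) ^ d i)"
        using hom_on_diff[OF is_subfield_UNIV Galois_hom[OF \<sigma>], of 0 "x i ^ d i"]
        by (simp add: hom_on_0[OF is_subfield_UNIV Galois_hom[OF \<sigma>]]
            hom_on_power[OF is_subfield_UNIV Galois_hom[OF \<sigma>]])
      finally have 1: "(\<Sum>k\<in>\<Delta> i. b_coeff K x i k * ?m k) = - (\<sigma> (x i) ^ d i)" .
      have w: "(\<Sum>k\<in>\<Delta> i. w \<rho> k * ?m k) = (if \<forall>j\<in>{1..i}. \<sigma> (x j) = \<rho> (x j) then 1 else 0)"
        if "\<rho> \<in> R" for \<rho>
      proof -
        have \<rho>: "\<rho> \<in> G" using that R_subset by blast
        have "(\<Sum>k\<in>\<Delta> i. w \<rho> k * ?m k) = (\<Prod>j=1..i. \<Sum>e=1..d j.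
            coeff (lagrange_poly (\<rho> (x j)) (B K x \<rho> j)) (d j - e) * \<sigma> (x j) ^ (d j - e))"
          unfolding w_def by (rule prod_sum_box[symmetric])
        also have "\<dots> = (\<Prod>j=1..i. poly (lagrange_poly (\<rho> (x j)) (B K x \<rho> j)) (\<sigma> (x j)))"
          using i by (intro prod.cong refl poly_eq_sum_reverse[symmetric]
              le_less_trans[OF degree_lagrange_le] card_B_less \<rho>) auto
        finally show ?thesis using lagrange_orthogonality[OF \<rho> \<sigma> i] by simp
      qed
      obtain \<rho>\<^sub>0 where \<rho>\<^sub>0: "\<rho>\<^sub>0 \<in> R" "\<forall>j\<in>{1..i}. \<sigma> (x j) = \<rho>\<^sub>0 (x j)"
        "\<And>\<rho>. \<rho> \<in> R \<Longrightarrow> \<forall>j\<in>{1..i}. \<sigma> (x j) = \<rho> (x j) \<Longrightarrow> \<rho> = \<rho>\<^sub>0"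
        using representative_ex1[OF \<sigma>] by blast
      have "(\<Sum>k\<in>\<Delta> i. (\<Sum>\<rho>\<in>R. \<rho> (x i) ^ d i * w \<rho> k) * ?m k) =
          (\<Sum>\<rho>\<in>R. \<rho> (x i) ^ d i * (\<Sum>k\<in>\<Delta> i. w \<rho> k * ?m k))"
        unfolding sum_distrib_left sum_distrib_right by (subst sum.swap) (simp only: mult.assoc)
      also have "\<dots> = (\<Sum>\<rho>\<in>R. if \<rho> = \<rho>\<^sub>0 then \<sigma> (x i) ^ d i else 0)"
      proof (rule sum.cong[OF refl])
        fix \<rho> assume \<rho>: "\<rho> \<in> R"
        show "\<rho> (x i) ^ d i * (\<Sum>k\<in>\<Delta> i. w \<rho> k * ?m k) = (if \<rho> = \<rho>\<^sub>0 then \<sigma> (x i) ^ d i else 0)"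
        proof (cases "\<rho> = \<rho>\<^sub>0")
          case True
          moreover have "\<sigma> (x i) = \<rho>\<^sub>0 (x i)" using \<rho>\<^sub>0(2) i by auto
          ultimately show ?thesis using w[OF \<rho>] \<rho>\<^sub>0(2) by simp
        next
          case False
          then have "\<not> (\<forall>j\<in>{1..i}. \<sigma> (x j) = \<rho> (x j))" using \<rho>\<^sub>0(3)[OF \<rho>] by blast
          then show ?thesis using w[OF \<rho>] False by (simp only: if_False mult_zero_right)
        qed
      qed
      also have "\<dots> = \<sigma> (x i) ^ d i" using finite_representatives \<rho>\<^sub>0(1) by simp
      finally have 2: "(\<Sum>k\<in>\<Delta> i. (\<Sum>\<rho>\<in>R. \<rho> (x i) ^ d i * w \<rho> k) * ?m k) = \<sigma> (x i) ^ d i" .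
      show "(\<Sum>k\<in>\<Delta> i. a k * ?m k) = 0"
        unfolding a_def distrib_right sum.distrib 1 2 by simp
    qed
  qed
  from bspec[OF this k] show ?thesis unfolding a_def w_def by (simp only: add_eq_0_iff2)
qed

text \<open>Expanding the products over the box reduces the identity of polynomials to the equality
  of scalar coefficients just obtained.\<close>

lemma f_hat_eq_interpolation:
  "f_hat K x i = T i ^ d i -
    (\<Sum>\<rho>\<in>R. Const (\<rho> (x i) ^ d i) *
      (\<Prod>j=1..i. \<Prod>y\<in>B K x \<rho> j. (T j - Const y) * Const (1 / (\<rho> (x j) - y))))"
proof -
  define w where "w \<rho> k = (\<Prod>j=1..i. coeff (lagrange_poly (\<rho> (x j)) (B K x \<rho> j)) (d j - k j))"
    for \<rho> and k :: "nat \<Rightarrow> nat"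
  have expand: "(\<Prod>j=1..i. \<Prod>y\<in>B K x \<rho> j. (T j - Const y) * Const (1 / (\<rho> (x j) - y))) =
      (\<Sum>k\<in>\<Delta> i. Const (w \<rho> k) * monomial i k T)" if "\<rho> \<in> R" for \<rho>
  proof -
    have \<rho>: "\<rho> \<in> G" using that R_subset by blast
    have "(\<Prod>j=1..i. \<Prod>y\<in>B K x \<rho> j. (T j - Const y) * Const (1 / (\<rho> (x j) - y))) =
        (\<Prod>j=1..i. \<Sum>e=1..d j.
          Const (coeff (lagrange_poly (\<rho> (x j)) (B K x \<rho> j)) (d j - e)) * T j ^ (d j - e))"
      unfolding poly_in_T_lagrange[symmetric]
      using i by (intro prod.cong refl poly_in_T_eq_sum_reverse
          le_less_trans[OF degree_lagrange_le] card_B_less \<rho>) auto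
    also have "\<dots> = (\<Sum>k\<in>\<Delta> i. Const (w \<rho> k) * monomial i k T)"
      unfolding w_def Const_prod by (rule prod_sum_box)
    finally show ?thesis .
  qed
  have "(\<Sum>\<rho>\<in>R. Const (\<rho> (x i) ^ d i) *
      (\<Prod>j=1..i. \<Prod>y\<in>B K x \<rho> j. (T j - Const y) * Const (1 / (\<rho> (x j) - y)))) =
      (\<Sum>\<rho>\<in>R. \<Sum>k\<in>\<Delta> i. Const (\<rho> (x i) ^ d i * w \<rho> k) * monomial i k T)"
    by (intro sum.cong refl) (simp only: expand sum_distrib_left Const_mult mult.assoc)
  also have "\<dots> = (\<Sum>k\<in>\<Delta> i. Const (\<Sum>\<rho>\<in>R. \<rho> (x i) ^ d i * w \<rho> k) * monomial i k T)"
    unfolding Const_sum sum_distrib_right by (rule sum.swap)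
  also have "\<dots> = - (\<Sum>k\<in>\<Delta> i. Const (b_coeff K x i k) * monomial i k T)"
    unfolding sum_negf[symmetric]
    by (intro sum.cong refl)
      (simp only: b_coeff_eq_interpolation w_def Const_uminus minus_mult_left[symmetric] minus_minus)
  finally show ?thesis unfolding f_hat_def by simp
qed

end

end

theorem theorem6:
  fixes K :: "'a::field set" and f :: "'a poly" and x :: "nat \<Rightarrow> 'a" and n :: nat
  assumes "is_subfield K"
    and "f \<in> polys_over K" and "lead_coeff f = 1" and "degree f = n"
    and "irreducible_over K f"
    and separable: "rsquarefree f"
    and zeros: "f = (\<Prod>i=1..n. [:- x i, 1:])"
    and generated: "field_adjoin K (x ` {1..n}) = UNIV"
    and i: "i \<in> {1..n}"
    and representatives:
      "left_coset_representatives (Galois_group K) (tower_stabilizer K x i) R"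
  shows "f_hat K x i = T i ^ tower_degree K x i -
    (\<Sum>\<rho>\<in>R. Const (\<rho> (x i) ^ tower_degree K x i) *
      (\<Prod>j=1..i. \<Prod>y\<in>B K x \<rho> j. (T j - Const y) * Const (1 / (\<rho> (x j) - y))))"
proof -
  \<comment> \<open>Substituting the factorisation into the separability hypothesis gives the
    injectivity of the numbering.\<close>
  interpret root_tower K f x n
    using assms(1,2) zeros generated inj_on_if_rsquarefree_prod[of x "{1..n}"] separable
    by unfold_locales simp_all
  show ?thesis using i representatives by (rule f_hat_eq_interpolation)
qed

end
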